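(* Let $m\ge 2$ and let $X_1,\ldots,X_m$ be independent identically distributed random points in $\mathbb{R}^2$ with the Archimedes density $$\frac{1}{2\pi\sqrt{1-x^2-y^2}}\quad\text{on the disc } x^2+y^2<1,$$ and let $\widehat\omega_m$ be the random geometric sorting network associated to $X_1,\ldots,X_m$. For every integer $j$ with $1\le j\le m-1$, the expected number of swaps in $\widehat\omega_m$ at location $j$ equals $$\frac{(j-\tfrac12)_{j-1}\,(m-j-\tfrac12)_{m-j-1}}{(j-1)!\,(m-j-1)!},$$ where $(a)_r:=a(a-1)\cdots(a-r+1)$ denotes the falling factorial.
   Context: Let $S_m$ be the symmetric group on $\{1,\ldots,m\}$, with composition $(\sigma\tau)(i):=\sigma(\tau(i))$. For $1\le s\le m-1$ let $\tau_s=(s\ \ s+1)\in S_m$ be the adjacent transposition, and let $\rho=(m,\ldots,2,1)$ be the reverse permutation. An $m$-particle sorting network is a sequence $(s_1,\ldots,s_M)$ with $M=\binom m2$ and $s_t\in\{1,\ldots,m-1\}$ such that $\tau_{s_1}\cdots\tau_{s_M}=\rho$. The number $s_t$ is the location of the $t$th swap, and the permutations $\sigma_t=\tau_{s_1}\cdots\tau_{s_t}$, $0\le t\le M$ ($\sigma_0$ the identity), are the configurations of the network; a network is determined by its sequence of configurations. Geometric sorting network: given $m$ points in $\mathbb{R}^2$ with no three collinear, no two on the same vertical line, and no two distinct pairs of points spanning parallel lines, label the points $x_1,\ldots,x_m$ in increasing order of their projections onto the horizontal axis. For all but finitely many angles $\theta\in[0,\pi]$, the orthogonal projections of the points onto the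 line through $0$ in direction $\theta$ (i.e. the values of the inner products with $(\cos\theta,\sin\theta)$) fall in a strictly increasing order $x_{\sigma(1)},\ldots,x_{\sigma(m)}$ for some permutation $\sigma=\sigma_\theta\in S_m$. As $\theta$ increases from $0$ to $\pi$, the successive distinct permutations $\sigma_\theta$ form the configurations of an $m$-particle sorting network, called the geometric sorting network associated to the set of points. The random points $X_1,\ldots,X_m$ satisfy the genericity conditions almost surely, so $\widehat\omega_m$ is almost surely well defined. In the falling factorial, $(a)_0=1$ (empty product), and $a$ may be any real number. *)

theory Defs
  imports "HOL-Probability.Probability" "HOL-Combinatorics.Combinatorics"
begin

definition adj_transp :: "nat \<Rightarrow> nat \<Rightarrow> nat" where
  "adj_transp s = Transposition.transpose s (Suc s)"

definition reverse_perm :: "nat \<Rightarrow> nat \<Rightarrow> nat" where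
  "reverse_perm m i = (if i \<in> {1..m} then m + 1 - i else i)"

text \<open>The configuration after \<open>t\<close> swaps; the \<open>t\<close>-th swap is located at \<open>s ! (t - 1)\<close>.\<close>

definition configuration :: "nat list \<Rightarrow> nat \<Rightarrow> nat \<Rightarrow> nat" where
  "configuration s t = foldr (\<circ>) (map adj_transp (take t s)) id"

definition sorting_network :: "nat \<Rightarrow> nat list \<Rightarrow> bool" where
  "sorting_network m s \<longleftrightarrow>
     length s = m choose 2 \<and> set s \<subseteq> {1..m - 1} \<and>
     configuration s (length s) = reverse_perm m"

text \<open>
  Point configurations are families \<open>p\<close> of points of the plane, of which only the values on
  \<open>{1..m}\<close> matter. The third clause makes the points pairwise distinct, so in the last clause
  both difference vectors are nonzero and proportionality means that the lines are parallel.
\<close>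

definition general_position :: "nat \<Rightarrow> (nat \<Rightarrow> real \<times> real) \<Rightarrow> bool" where
  "general_position m p \<longleftrightarrow>
     (\<forall>a\<in>{1..m}. \<forall>b\<in>{1..m}. \<forall>c\<in>{1..m}. a \<noteq> b \<and> b \<noteq> c \<and> a \<noteq> c \<longrightarrow>
        \<not> collinear {p a, p b, p c}) \<and>
     (\<forall>a\<in>{1..m}. \<forall>b\<in>{1..m}. a \<noteq> b \<longrightarrow> fst (p a) \<noteq> fst (p b)) \<and>
     (\<forall>a\<in>{1..m}. \<forall>b\<in>{1..m}. \<forall>c\<in>{1..m}. \<forall>d\<in>{1..m}.
        a \<noteq> b \<and> c \<noteq> d \<and> {a, b} \<noteq> {c, d} \<longrightarrow>
        \<not> (\<exists>r. p b - p a = r *\<^sub>R (p d - p c)))"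

definition x_ordered :: "nat \<Rightarrow> (nat \<Rightarrow> real \<times> real) \<Rightarrow> nat \<Rightarrow> real \<times> real" where
  "x_ordered m p =
     p \<circ> (THE \<pi>. \<pi> permutes {1..m} \<and> strict_mono_on {1..m} (\<lambda>i. fst (p (\<pi> i))))"

text \<open>\<open>proj_order m x \<theta> \<sigma>\<close> states that \<open>\<sigma>\<^sub>\<theta>\<close> is defined for the points \<open>x\<close> and equals \<open>\<sigma>\<close>.\<close>

definition proj_order ::
  "nat \<Rightarrow> (nat \<Rightarrow> real \<times> real) \<Rightarrow> real \<Rightarrow> (nat \<Rightarrow> nat) \<Rightarrow> bool" where
  "proj_order m x \<theta> \<sigma> \<longleftrightarrow>
     \<sigma> permutes {1..m} \<and> strict_mono_on {1..m} (\<lambda>i. x (\<sigma> i) \<bullet> (cos \<theta>, sin \<theta>))"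

definition regular_angles :: "nat \<Rightarrow> (nat \<Rightarrow> real \<times> real) \<Rightarrow> real set" where
  "regular_angles m x = {\<theta> \<in> {0..pi}. \<exists>\<sigma>. proj_order m x \<theta> \<sigma>}"

text \<open>
  The successive distinct permutations \<open>\<sigma>\<^sub>\<theta>\<close> are the configurations of the network \<open>s\<close>: here
  \<open>k \<theta>\<close> is the number of swaps performed up to the angle \<open>\<theta>\<close>, so \<open>k\<close> is nondecreasing and no
  configuration is skipped. Consecutive configurations of a network differ, so this determines \<open>s\<close>.
\<close>

definition is_geometric_network :: "nat \<Rightarrow> (nat \<Rightarrow> real \<times> real) \<Rightarrow> nat list \<Rightarrow> bool" where
  "is_geometric_network m x s \<longleftrightarrow>
     sorting_network m s \<and>
     (\<exists>k. mono_on (regular_angles m x) k \<and>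
          k ` regular_angles m x = {0..length s} \<and>
          (\<forall>\<theta>\<in>regular_angles m x. proj_order m x \<theta> (configuration s (k \<theta>))))"

text \<open>The empty list is a dummy value for points that are not in general position.\<close>

definition geometric_network :: "nat \<Rightarrow> (nat \<Rightarrow> real \<times> real) \<Rightarrow> nat list" where
  "geometric_network m p =
     (if general_position m p then THE s. is_geometric_network m (x_ordered m p) s else [])"

definition swaps_at :: "nat list \<Rightarrow> nat \<Rightarrow> nat" where
  "swaps_at s j = card {t. t < length s \<and> s ! t = j}"

definition archimedes_density :: "real \<times> real \<Rightarrow> real" where
  "archimedes_density = (\<lambda>(x, y).
     if x\<^sup>2 + y\<^sup>2 < 1 then 1 / (2 * pi * sqrt (1 - x\<^sup>2 - y\<^sup>2)) else 0)"

definition falling_factorial :: "real \<Rightarrow> nat \<Rightarrow> real" where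
  "falling_factorial a r = (\<Prod>i<r. a - real i)"

end

theory Submission imports Defs begin

text \<open>
  At angle \<open>\<theta>\<close> two points swap exactly when the direction \<open>\<theta>\<close> is orthogonal to the line through
  them, and the location of that swap is one more than the number of points below this line. So the
  swaps at location \<open>j\<close> correspond to the pairs of points with exactly \<open>j - 1\<close> of the remaining points
  below their line. Parametrise lines by slope \<open>k\<close> and intercept \<open>c\<close>; the signed distance from the
  origin is \<open>r = c / sqrt (1 + k\<^sup>2)\<close>. Projections of the Archimedes distribution are uniform on
  \<open>{-1..1}\<close>, so a point lies below the line with probability \<open>(1 + r) / 2\<close>. The restriction of the
  density to a line is an arcsine density up to scaling, so changing variables from two points to
  their line and abscissae shows that \<open>r\<close> has the semicircle law for the line through two random
  points. The expectation thus reduces to a Beta integral with half-integer parameters.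
\<close>

subsection \<open>The Archimedes density on a line\<close>

text \<open>Lines are integrated over pairs of points ordered from left to right, which makes the
  Jacobian positive; the resulting measure on lines has mass 1/2, and a sum over ordered pairs of
  indices counts each line once. On a chord the Jacobian contributes the mean distance of two
  arcsine variables, scaled by the half-length \<open>sqrt (1 - r^2)\<close> of the chord: this is
  the origin of the semicircle law. Passing from the intercept to \<open>r\<close> leaves only a
  factor \<open>1 / (1 + k^2)\<close> of the slope, so the slope is Cauchy and independent of
  \<open>r\<close>. On the combinatorial side the obstacle is that a network is given by a definite
  description which admits any monotone counting function. That function must be shown to be the
  number of swap angles passed: swap angles of distinct pairs differ because their slopes do, and
  consecutive configurations of a network are never equal. The identity between swaps and lines is
  then deterministic in general position; elsewhere, on a null set, the dummy network has no
  swaps.\<close>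

lemma borel_measurable_archimedes_density [measurable]:
  "archimedes_density \<in> borel_measurable borel"
proof -
  have *: "archimedes_density = (\<lambda>z. if (fst z)\<^sup>2 + (snd z)\<^sup>2 < 1
      then 1 / (2 * pi * sqrt (1 - (fst z)\<^sup>2 - (snd z)\<^sup>2)) else 0)"
    by (auto simp: archimedes_density_def fun_eq_iff)
  show ?thesis
    unfolding * borel_prod [symmetric] by measurable
qed

lemma archimedes_density_nonneg: "0 \<le> archimedes_density z"
  by (cases z) (auto simp: archimedes_density_def)

section \<open>Integrals of the arcsine weight\<close>

text \<open>The arcsine density without its factor \<open>1 / pi\<close>. Being 0 off the open
  interval, like \<open>archimedes_density\<close> off the disc, it lets integrals run over the
  whole line.\<close>

definition arcsine_weight :: "real \<Rightarrow> real" where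
  "arcsine_weight s = (if s\<^sup>2 < 1 then 1 / sqrt (1 - s\<^sup>2) else 0)"

lemma borel_measurable_arcsine_weight [measurable]: "arcsine_weight \<in> borel_measurable borel"
  unfolding arcsine_weight_def by measurable

lemma arcsine_weight_nonneg: "0 \<le> arcsine_weight s"
  by (simp add: arcsine_weight_def)

lemma square_less_one_iff: "s\<^sup>2 < 1 \<longleftrightarrow> -1 < s \<and> s < (1::real)"
  using abs_square_less_1[of s] by auto

lemma DERIV_arcsin_weight:
  assumes "-1 < s" "s < 1"
  shows "(arcsin has_real_derivative arcsine_weight s) (at s)"
  using DERIV_arcsin[OF assms] assms square_less_one_iff[of s]
  by (simp add: arcsine_weight_def field_simps)

lemma DERIV_sqrt_one_minus_square:
  assumes "-1 < s" "s < 1"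
  shows "((\<lambda>s. sqrt (1 - s\<^sup>2)) has_real_derivative - s * arcsine_weight s) (at s)"
proof -
  have "s\<^sup>2 < 1" using assms square_less_one_iff by simp
  then show ?thesis
    by (auto intro!: derivative_eq_intros simp: arcsine_weight_def field_simps)
qed

lemma sqrt_times_arcsine_weight:
  assumes "-1 < s" "s < 1"
  shows "sqrt (1 - s\<^sup>2) * arcsine_weight s = 1"
  using assms square_less_one_iff[of s] by (simp add: arcsine_weight_def)

lemma nn_integral_arcsine_weight: "(\<integral>\<^sup>+s. ennreal (arcsine_weight s) \<partial>lborel) = ennreal pi"
proof -
  \<comment> \<open>The weight blows up at both ends, but its antiderivative \<open>arcsin\<close>
    is continuous on the closed interval, so derivatives in the interior are enough.\<close>
  have "(arcsine_weight has_integral arcsin 1 - arcsin (-1)) {-1..1}"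
    by (rule fundamental_theorem_of_calculus_interior)
      (auto intro!: continuous_intros DERIV_arcsin_weight
        simp flip: has_real_derivative_iff_has_vector_derivative)
  then have "(\<integral>\<^sup>+s. ennreal (arcsine_weight s) * indicator {-1..1} s \<partial>lborel) = ennreal pi"
    using nn_integral_has_integral_lebesgue'[of "{-1..1}" arcsine_weight]
    by (simp add: arcsine_weight_nonneg arcsin_minus)
  also have "(\<integral>\<^sup>+s. ennreal (arcsine_weight s) * indicator {-1..1} s \<partial>lborel)
      = (\<integral>\<^sup>+s. ennreal (arcsine_weight s) \<partial>lborel)"
    by (intro nn_integral_cong) (auto simp: arcsine_weight_def square_less_one_iff indicator_def)
  finally show ?thesis .
qed

lemma has_integral_arcsine_weight_right:
  assumes s: "-1 < s" "s < 1"
  shows "((\<lambda>u. (u - s) * arcsine_weight u) has_integral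
    sqrt (1 - s\<^sup>2) - s * (pi / 2 - arcsin s)) {s..1}"
proof -
  let ?F = "\<lambda>u. - sqrt (1 - u\<^sup>2) - s * arcsin u"
  have "((\<lambda>u. (u - s) * arcsine_weight u) has_integral ?F 1 - ?F s) {s..1}"
  proof (rule fundamental_theorem_of_calculus_interior)
    show "continuous_on {s..1} ?F"
      using s by (auto intro!: continuous_intros)
    fix u assume "u \<in> {s<..<1}"
    then have u: "-1 < u" "u < 1" using s by auto
    show "(?F has_vector_derivative (u - s) * arcsine_weight u) (at u)"
      unfolding has_real_derivative_iff_has_vector_derivative [symmetric]
      by (rule derivative_eq_intros DERIV_sqrt_one_minus_square DERIV_arcsin_weight u refl
          | simp add: algebra_simps)+
  qed (use s in auto)
  then show ?thesis
    by (simp add: algebra_simps)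
qed

lemma nn_integral_arcsine_weight_right:
  assumes s: "-1 < s" "s < 1"
  shows "(\<integral>\<^sup>+u. ennreal (indicator {s<..} u * (u - s) * arcsine_weight u) \<partial>lborel)
    = ennreal (sqrt (1 - s\<^sup>2) - s * (pi / 2 - arcsin s))"
proof -
  have "(\<integral>\<^sup>+u. ennreal ((u - s) * arcsine_weight u) * indicator {s..1} u \<partial>lborel)
     = ennreal (sqrt (1 - s\<^sup>2) - s * (pi / 2 - arcsin s))"
    using has_integral_arcsine_weight_right[OF s]
    by (intro nn_integral_has_integral_lebesgue') (auto simp: arcsine_weight_nonneg)
  also have "(\<integral>\<^sup>+u. ennreal ((u - s) * arcsine_weight u) * indicator {s..1} u \<partial>lborel)
    = (\<integral>\<^sup>+u. ennreal (indicator {s<..} u * (u - s) * arcsine_weight u) \<partial>lborel)"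
    by (intro nn_integral_cong) (auto simp: arcsine_weight_def square_less_one_iff indicator_def)
  finally show ?thesis .
qed

text \<open>The mean distance of two independent arcsine variables is \<open>8 / pi^2\<close>;
  keeping only \<open>u > s\<close> halves it, and the missing normalisations multiply it by
  \<open>pi^2\<close>, which leaves 4.\<close>

lemma arcsine_weight_mean_positive_difference:
  "(\<integral>\<^sup>+s. \<integral>\<^sup>+u. ennreal (arcsine_weight s) *
      ennreal (indicator {s<..} u * (u - s) * arcsine_weight u) \<partial>lborel \<partial>lborel) = 4"
proof -
  \<comment> \<open>\<open>?g\<close> is the outer integrand after cancelling
    \<open>sqrt (1 - s^2) * arcsine_weight s = 1\<close>. The product term of \<open>?F\<close> has
    derivative \<open>?g s - 2\<close>, hence the summand \<open>2 * s\<close>; the product vanishes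
    at both ends, so only \<open>2 * s\<close> contributes to the value.\<close>
  let ?g = "\<lambda>s. 1 - s * arcsine_weight s * (pi / 2 - arcsin s)"
  let ?F = "\<lambda>s. 2 * s + sqrt (1 - s\<^sup>2) * (pi / 2 - arcsin s)"
  have g_eq: "?g s = arcsine_weight s * (sqrt (1 - s\<^sup>2) - s * (pi / 2 - arcsin s))"
    if "-1 < s" "s < 1" for s
    using sqrt_times_arcsine_weight[OF that] by (simp add: algebra_simps)
  have nonneg: "0 \<le> sqrt (1 - s\<^sup>2) - s * (pi / 2 - arcsin s)" if s: "-1 < s" "s < 1" for s
    using has_integral_arcsine_weight_right[OF s]
    by (rule has_integral_nonneg) (auto simp: arcsine_weight_nonneg)
  have "(?g has_integral ?F 1 - ?F (-1)) {-1..1}"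
  proof (rule fundamental_theorem_of_calculus_interior)
    show "continuous_on {-1..1} ?F"
      by (auto intro!: continuous_intros)
    fix s :: real assume "s \<in> {-1<..<1}"
    then have s: "-1 < s" "s < 1" by auto
    show "(?F has_vector_derivative ?g s) (at s)"
      unfolding has_real_derivative_iff_has_vector_derivative [symmetric]
      by (rule derivative_eq_intros DERIV_sqrt_one_minus_square DERIV_arcsin_weight s refl)+
        (use sqrt_times_arcsine_weight[OF s] in \<open>simp add: algebra_simps\<close>)
  qed auto
  then have "(?g has_integral 4) {-1..1}" by simp
  then have "(?g has_integral 4) {-1<..<1}"
    by (simp add: has_integral_Icc_iff_Ioo)
  then have "(\<integral>\<^sup>+s. ennreal (?g s) * indicator {-1<..<1} s \<partial>lborel) = ennreal 4"
    using nonneg g_eq arcsine_weight_nonneg by (intro nn_integral_has_integral_lebesgue') auto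
  moreover have "(\<integral>\<^sup>+u. ennreal (arcsine_weight s) *
      ennreal (indicator {s<..} u * (u - s) * arcsine_weight u) \<partial>lborel)
      = ennreal (?g s) * indicator {-1<..<1} s" for s
  proof (cases "-1 < s \<and> s < 1")
    case True
    then have s: "-1 < s" "s < 1" by auto
    show ?thesis
      using s by (simp add: nn_integral_cmult nn_integral_arcsine_weight_right g_eq[OF s]
          ennreal_mult[OF arcsine_weight_nonneg nonneg[OF s]])
  next
    case False
    then show ?thesis by (auto simp: arcsine_weight_def square_less_one_iff)
  qed
  ultimately show ?thesis by simp
qed

section \<open>The density along a chord of the disc\<close>

text \<open>The chord has midpoint abscissa \<open>- k * c / n^2\<close> (the foot of the
  perpendicular from the origin) and half-length \<open>R\<close>, whose horizontal extent is
  \<open>R / n\<close>; \<open>s\<close> runs along it from -1 to 1. By Pythagoras the quantity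
  under the root in the density becomes \<open>R^2 * (1 - s^2)\<close>.\<close>

lemma archimedes_density_on_line:
  fixes k c s :: real
  defines "n \<equiv> sqrt (1 + k\<^sup>2)" and "R \<equiv> sqrt (1 - (c / sqrt (1 + k\<^sup>2))\<^sup>2)"
  defines "x \<equiv> - k * c / n\<^sup>2 + R / n * s"
  assumes c: "\<bar>c\<bar> < n"
  shows "archimedes_density (x, k * x + c) = arcsine_weight s / (2 * pi * R)"
proof -
  have N: "n\<^sup>2 = 1 + k\<^sup>2" "n > 0" by (auto simp: n_def add_pos_nonneg)
  have "(c / n)\<^sup>2 < 1"
    using c N by (simp add: abs_square_less_1 abs_divide)
  then have R: "R\<^sup>2 = 1 - (c/n)\<^sup>2" "R > 0"
    by (auto simp: R_def n_def)
  have nR: "n\<^sup>2 * R\<^sup>2 = n\<^sup>2 - c\<^sup>2"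
    using N(2) by (simp add: R(1) right_diff_distrib power_divide)
  have "n\<^sup>2 * (1 - x\<^sup>2 - (k * x + c)\<^sup>2) = n\<^sup>2 - (n\<^sup>2 * x + k * c)\<^sup>2 - c\<^sup>2"
    using N(1) by algebra
  also have "n\<^sup>2 * x + k * c = n * R * s"
    using N(2) by (simp add: x_def right_diff_distrib power2_eq_square)
  also have "n\<^sup>2 - (n * R * s)\<^sup>2 - c\<^sup>2 = n\<^sup>2 * (R\<^sup>2 * (1 - s\<^sup>2))"
    using nR by algebra
  finally have eq: "1 - x\<^sup>2 - (k * x + c)\<^sup>2 = R\<^sup>2 * (1 - s\<^sup>2)"
    using N(2) by simp
  have "x\<^sup>2 + (k * x + c)\<^sup>2 < 1 \<longleftrightarrow> s\<^sup>2 < 1"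
    using eq R(2) zero_less_mult_iff[of "R\<^sup>2" "1 - s\<^sup>2"] by (smt (verit) zero_less_power2)
  then show ?thesis
    unfolding archimedes_density_def arcsine_weight_def
    using R(2) by (auto simp: eq real_sqrt_mult)
qed

text \<open>Such a line has distance at least 1 from the origin; the identity in the proof is
  Pythagoras for the foot of the perpendicular, cleared of denominators.\<close>

lemma archimedes_density_off_disc:
  assumes c: "sqrt (1 + k\<^sup>2) \<le> \<bar>c\<bar>"
  shows "archimedes_density (x, k * x + c) = 0"
proof -
  have "1 + k\<^sup>2 \<le> c\<^sup>2"
    using c by (metis abs_le_square_iff abs_of_nonneg real_sqrt_ge_zero real_sqrt_pow2 
        add_nonneg_nonneg zero_le_one zero_le_power2)
  moreover have "(1 + k\<^sup>2) * (x\<^sup>2 + (k * x + c)\<^sup>2) = ((1 + k\<^sup>2) * x + k * c)\<^sup>2 + c\<^sup>2"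
    by algebra
  ultimately have "(1 + k\<^sup>2) * 1 \<le> (1 + k\<^sup>2) * (x\<^sup>2 + (k * x + c)\<^sup>2)"
    by (smt (verit) zero_le_power2)
  moreover have "0 < 1 + k\<^sup>2" by (simp add: add_pos_nonneg)
  ultimately have "1 \<le> x\<^sup>2 + (k * x + c)\<^sup>2"
    using mult_le_cancel_left_pos by blast
  then show ?thesis by (simp add: archimedes_density_def)
qed


text \<open>The substitution has \<open>dx = R / n ds\<close>, and this \<open>R\<close> cancels the
  one in the density, so the total weight of a chord depends on its slope alone.\<close>

lemma nn_integral_archimedes_density_on_line:
  fixes k c :: real
  defines "n \<equiv> sqrt (1 + k\<^sup>2)" and "R \<equiv> sqrt (1 - (c / sqrt (1 + k\<^sup>2))\<^sup>2)"
  assumes c: "\<bar>c\<bar> < n" and [measurable]: "h \<in> borel_measurable borel"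
  shows "(\<integral>\<^sup>+x. ennreal (archimedes_density (x, k * x + c)) * h x \<partial>lborel)
    = ennreal (1 / (2 * pi * n)) *
      (\<integral>\<^sup>+s. ennreal (arcsine_weight s) * h (- k * c / n\<^sup>2 + R / n * s) \<partial>lborel)"
proof -
  have N: "n > 0" by (auto simp: n_def add_pos_nonneg)
  have "(c / n)\<^sup>2 < 1"
    using c N by (simp add: abs_square_less_1 abs_divide)
  then have R: "R > 0"
    by (auto simp: R_def n_def)
  have [measurable]: "(\<lambda>x. archimedes_density (x, k * x + c)) \<in> borel_measurable borel"
    by measurable
  have *: "ennreal (R / n) * ennreal (arcsine_weight s / (2 * pi * R)) =
      ennreal (1 / (2 * pi * n)) * ennreal (arcsine_weight s)" for s
    using N R by (simp add: arcsine_weight_nonneg field_simps flip: ennreal_mult)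
  have "(\<integral>\<^sup>+x. ennreal (archimedes_density (x, k * x + c)) * h x \<partial>lborel) = \<bar>R / n\<bar> *
    (\<integral>\<^sup>+s. ennreal (archimedes_density (- k * c / n\<^sup>2 + R / n * s, k * (- k * c / n\<^sup>2 + R / n * s) + c))
      * h (- k * c / n\<^sup>2 + R / n * s) \<partial>lborel)"
    using N R by (intro nn_integral_real_affine) auto
  also have "\<dots> = (\<integral>\<^sup>+s. ennreal (R / n) * (ennreal (arcsine_weight s / (2 * pi * R))
      * h (- k * c / n\<^sup>2 + R / n * s)) \<partial>lborel)"
    using archimedes_density_on_line[of c k] c N R
    by (subst nn_integral_cmult) (simp_all add: n_def R_def)
  also have "(\<integral>\<^sup>+s. ennreal (R / n) * (ennreal (arcsine_weight s / (2 * pi * R))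
      * h (- k * c / n\<^sup>2 + R / n * s)) \<partial>lborel) =
    (\<integral>\<^sup>+s. ennreal (1 / (2 * pi * n)) * (ennreal (arcsine_weight s)
      * h (- k * c / n\<^sup>2 + R / n * s)) \<partial>lborel)"
    by (simp only: mult.assoc [symmetric] *)
  finally show ?thesis
    by (subst (asm) nn_integral_cmult) auto
qed

text \<open>Archimedes' hat-box theorem: since \<open>dc = sqrt (1 + k^2) dr\<close>, this is the
  uniform density 1/2 in the signed distance \<open>r\<close>.\<close>

lemma nn_integral_archimedes_density_line:
  "(\<integral>\<^sup>+x. ennreal (archimedes_density (x, k * x + c)) \<partial>lborel)
    = ennreal (indicator {- sqrt (1 + k\<^sup>2)<..<sqrt (1 + k\<^sup>2)} c / (2 * sqrt (1 + k\<^sup>2)))"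
proof (cases "\<bar>c\<bar> < sqrt (1 + k\<^sup>2)")
  case True
  have "0 < sqrt (1 + k\<^sup>2)" by (simp add: add_pos_nonneg)
  then show ?thesis
    using True nn_integral_archimedes_density_on_line[OF True, of "\<lambda>_. 1"]
    by (simp add: nn_integral_arcsine_weight abs_less_iff flip: ennreal_mult)
next
  case False
  then show ?thesis
    by (auto simp: archimedes_density_off_disc abs_less_iff indicator_def)
qed

text \<open>Each point contributes \<open>1 / (2 * pi * n)\<close>, the difference of abscissae
  scales by \<open>R / n\<close>, and what remains is the integral with value 4.\<close>

lemma archimedes_density_line_pair:
  fixes k c :: real
  defines "n \<equiv> sqrt (1 + k\<^sup>2)"
  assumes c: "\<bar>c\<bar> < n"
  shows "(\<integral>\<^sup>+x. \<integral>\<^sup>+x'. ennreal (archimedes_density (x, k * x + c)) *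
        (ennreal (archimedes_density (x', k * x' + c)) * ennreal (indicator {x<..} x' * (x' - x)))
      \<partial>lborel \<partial>lborel)
    = ennreal (sqrt (1 - (c / n)\<^sup>2) / (pi\<^sup>2 * n ^ 3))"
proof -
  define R where "R = sqrt (1 - (c / n)\<^sup>2)"
  define \<xi> where "\<xi> s = - k * c / n\<^sup>2 + R / n * s" for s
  have N: "n > 0" by (auto simp: n_def add_pos_nonneg)
  have "(c / n)\<^sup>2 < 1"
    using c N by (simp add: abs_square_less_1 abs_divide)
  then have R: "R > 0"
    by (auto simp: R_def)
  have [measurable]: "(\<lambda>x. archimedes_density (x, k * x + c)) \<in> borel_measurable borel"
    by measurable
  have [measurable]: "\<xi> \<in> borel_measurable borel"
    unfolding \<xi>_def by measurable
  have line: "(\<integral>\<^sup>+x. ennreal (archimedes_density (x, k * x + c)) * h x \<partial>lborel)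
      = ennreal (1 / (2 * pi * n)) * (\<integral>\<^sup>+s. ennreal (arcsine_weight s) * h (\<xi> s) \<partial>lborel)"
    if "h \<in> borel_measurable borel" for h
    using nn_integral_archimedes_density_on_line[OF c[unfolded n_def] that]
    by (simp add: n_def R_def \<xi>_def)
  \<comment> \<open>The chord parametrisation is increasing, so it preserves the order condition,
    and its offset cancels in the difference.\<close>
  have diff: "indicator {\<xi> s<..} (\<xi> u) * (\<xi> u - \<xi> s) = R / n * (indicator {s<..} u * (u - s))" for s u
    using N R by (auto simp: \<xi>_def indicator_def field_simps)
  have inner: "ennreal (arcsine_weight s) *
      (ennreal (1 / (2 * pi * n)) * (\<integral>\<^sup>+u. ennreal (arcsine_weight u) *
        ennreal (indicator {\<xi> s<..} (\<xi> u) * (\<xi> u - \<xi> s)) \<partial>lborel)) = 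
      (ennreal (1 / (2 * pi * n)) * ennreal (R / n)) *
      (\<integral>\<^sup>+u. ennreal (arcsine_weight s) * 
        ennreal (indicator {s<..} u * (u - s) * arcsine_weight u) \<partial>lborel)" for s
  proof -
    have "(\<integral>\<^sup>+u. ennreal (arcsine_weight u) *
        ennreal (indicator {\<xi> s<..} (\<xi> u) * (\<xi> u - \<xi> s)) \<partial>lborel)
      = (\<integral>\<^sup>+u. ennreal (R / n) * ennreal (indicator {s<..} u * (u - s) * arcsine_weight u) \<partial>lborel)"
      unfolding diff using N R
      by (intro nn_integral_cong)
        (auto simp: arcsine_weight_nonneg indicator_def ac_simps simp flip: ennreal_mult)
    also have "\<dots> = ennreal (R / n) *
        (\<integral>\<^sup>+u. ennreal (indicator {s<..} u * (u - s) * arcsine_weight u) \<partial>lborel)"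
      by (intro nn_integral_cmult) measurable
    moreover have "(\<integral>\<^sup>+u. ennreal (arcsine_weight s) * 
        ennreal (indicator {s<..} u * (u - s) * arcsine_weight u) \<partial>lborel) =
        ennreal (arcsine_weight s) *
        (\<integral>\<^sup>+u. ennreal (indicator {s<..} u * (u - s) * arcsine_weight u) \<partial>lborel)"
      by (intro nn_integral_cmult) measurable
    ultimately show ?thesis
      by (simp add: ac_simps)
  qed
  have m': "(\<lambda>s. \<integral>\<^sup>+u. ennreal (arcsine_weight s) *
      ennreal (indicator {s<..} u * (u - s) * arcsine_weight u) \<partial>lborel)
      \<in> borel_measurable lborel"
    unfolding indicator_def greaterThan_iff by measurable
  have m: "(\<lambda>x. \<integral>\<^sup>+u. ennreal (archimedes_density (u, k * u + c)) *
          ennreal (indicator {x<..} u * (u - x)) \<partial>lborel) \<in> borel_measurable borel"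
    unfolding indicator_def greaterThan_iff by measurable
  have "(\<integral>\<^sup>+x. \<integral>\<^sup>+x'. ennreal (archimedes_density (x, k * x + c)) *
        (ennreal (archimedes_density (x', k * x' + c)) * ennreal (indicator {x<..} x' * (x' - x)))
      \<partial>lborel \<partial>lborel)
    = (\<integral>\<^sup>+x. ennreal (archimedes_density (x, k * x + c)) * (\<integral>\<^sup>+x'. 
        ennreal (archimedes_density (x', k * x' + c)) * ennreal (indicator {x<..} x' * (x' - x))
      \<partial>lborel) \<partial>lborel)"
    by (intro nn_integral_cong nn_integral_cmult) measurable
  also have "\<dots> = ennreal (1 / (2 * pi * n)) * (\<integral>\<^sup>+s. ennreal (arcsine_weight s) *
      (\<integral>\<^sup>+x'. ennreal (archimedes_density (x', k * x' + c)) *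
        ennreal (indicator {\<xi> s<..} x' * (x' - \<xi> s)) \<partial>lborel) \<partial>lborel)"
    by (rule line[OF m])
  also have "\<dots> = ennreal (1 / (2 * pi * n)) * (\<integral>\<^sup>+s. ennreal (arcsine_weight s) *
      (ennreal (1 / (2 * pi * n)) * (\<integral>\<^sup>+u. ennreal (arcsine_weight u) *
        ennreal (indicator {\<xi> s<..} (\<xi> u) * (\<xi> u - \<xi> s)) \<partial>lborel)) \<partial>lborel)"
    by (subst line) measurable
  also have "\<dots> = ennreal (1 / (2 * pi * n)) * (\<integral>\<^sup>+s. (ennreal (1 / (2 * pi * n)) * ennreal (R / n)) *
      (\<integral>\<^sup>+u. ennreal (arcsine_weight s) * 
        ennreal (indicator {s<..} u * (u - s) * arcsine_weight u) \<partial>lborel) \<partial>lborel)"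
    by (simp only: inner)
  also have "\<dots> = ennreal (1 / (2 * pi * n)) * ((ennreal (1 / (2 * pi * n)) * ennreal (R / n)) * 4)"
    by (simp only: nn_integral_cmult [OF m'] arcsine_weight_mean_positive_difference)
  also have "\<dots> = ennreal (R / (pi\<^sup>2 * n ^ 3))"
    using N R by (simp add: power2_eq_square power3_eq_cube ac_simps flip: ennreal_mult ennreal_numeral)
  finally show ?thesis
    by (simp add: R_def)
qed

definition slope :: "real \<times> real \<Rightarrow> real \<times> real \<Rightarrow> real" where
  "slope p q = (snd q - snd p) / (fst q - fst p)"

definition intercept :: "real \<times> real \<Rightarrow> real \<times> real \<Rightarrow> real" where
  "intercept p q = snd p - slope p q * fst p"

definition below_line :: "real \<Rightarrow> real \<Rightarrow> (real \<times> real) set" where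
  "below_line k c = {z. snd z < k * fst z + c}"

subsection \<open>The line through two random points\<close>

lemma borel_measurable_fst_snd_real [measurable]:
  "(fst :: real \<times> real \<Rightarrow> real) \<in> borel_measurable borel"
  "(snd :: real \<times> real \<Rightarrow> real) \<in> borel_measurable borel"
  unfolding borel_prod [symmetric] by measurable

lemma sets_below_line [measurable]: "below_line k c \<in> sets borel"
proof -
  have "{z \<in> space borel. snd z < k * fst z + c} \<in> sets borel"
    by measurable
  then show ?thesis
    by (simp add: below_line_def)
qed

lemma borel_measurable_slope [measurable]:
  "(\<lambda>(p, q). slope p q) \<in> borel_measurable (borel \<Otimes>\<^sub>M borel)"
  unfolding slope_def by measurable

lemma borel_measurable_intercept [measurable]:
  "(\<lambda>(p, q). intercept p q) \<in> borel_measurable (borel \<Otimes>\<^sub>M borel)"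
  unfolding intercept_def slope_def by measurable

lemma nn_integral_lborel_plane:
  fixes f :: "real \<times> real \<Rightarrow> ennreal"
  assumes "f \<in> borel_measurable borel"
  shows "(\<integral>\<^sup>+z. f z \<partial>lborel) = (\<integral>\<^sup>+x. \<integral>\<^sup>+y. f (x, y) \<partial>lborel \<partial>lborel)"
proof -
  have "f \<in> borel_measurable ((lborel :: real measure) \<Otimes>\<^sub>M (lborel :: real measure))"
    using assms by (simp add: lborel_prod)
  then show ?thesis
    using lborel.nn_integral_fst [of f "lborel :: real measure"] by (simp add: lborel_prod)
qed

lemma nn_integral_lborel_swap:
  fixes f :: "real \<Rightarrow> real \<Rightarrow> ennreal"
  assumes "case_prod f \<in> borel_measurable (borel \<Otimes>\<^sub>M borel)"
  shows "(\<integral>\<^sup>+x. \<integral>\<^sup>+y. f x y \<partial>lborel \<partial>lborel) = (\<integral>\<^sup>+y. \<integral>\<^sup>+x. f x y \<partial>lborel \<partial>lborel)"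
proof -
  have "case_prod f \<in> borel_measurable (lborel \<Otimes>\<^sub>M lborel)"
    using assms by (simp cong: measurable_cong_sets)
  then show ?thesis
    by (rule lborel_pair.Fubini' [symmetric])
qed

text \<open>The vertical shear \<open>y = k * x + d\<close> turns the half-plane into
  \<open>d < c\<close>; integrating over \<open>x\<close> first leaves the constant intercept
  density \<open>1 / (2 * sqrt (1 + k^2))\<close>.\<close>

lemma nn_integral_archimedes_density_below_line:
  assumes c: "\<bar>c\<bar> < sqrt (1 + k\<^sup>2)"
  shows "(\<integral>\<^sup>+z. ennreal (archimedes_density z) * indicator (below_line k c) z \<partial>lborel)
    = ennreal ((1 + c / sqrt (1 + k\<^sup>2)) / 2)"
proof -
  let ?n = "sqrt (1 + k\<^sup>2)"
  have "(\<integral>\<^sup>+z. ennreal (archimedes_density z) * indicator (below_line k c) z \<partial>lborel)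
    = (\<integral>\<^sup>+x. \<integral>\<^sup>+y. ennreal (archimedes_density (x, y)) * indicator (below_line k c) (x, y)
        \<partial>lborel \<partial>lborel)"
    by (intro nn_integral_lborel_plane) measurable
  also have "\<dots> = (\<integral>\<^sup>+x. \<integral>\<^sup>+d. ennreal (archimedes_density (x, k * x + d)) * indicator {..<c} d
        \<partial>lborel \<partial>lborel)"
  proof (rule nn_integral_cong)
    fix x
    have "(\<integral>\<^sup>+y. ennreal (archimedes_density (x, y)) * indicator (below_line k c) (x, y) \<partial>lborel)
      = ennreal \<bar>1\<bar> * (\<integral>\<^sup>+d. ennreal (archimedes_density (x, k * x + 1 * d)) *
          indicator (below_line k c) (x, k * x + 1 * d) \<partial>lborel)"
      by (intro nn_integral_real_affine) measurable
    also have "\<dots> = (\<integral>\<^sup>+d. ennreal (archimedes_density (x, k * x + d)) * indicator {..<c} d \<partial>lborel)"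
      by (simp add: below_line_def indicator_def)
    finally show "(\<integral>\<^sup>+y. ennreal (archimedes_density (x, y)) * indicator (below_line k c) (x, y) \<partial>lborel)
      = (\<integral>\<^sup>+d. ennreal (archimedes_density (x, k * x + d)) * indicator {..<c} d \<partial>lborel)" .
  qed
  also have "\<dots> = (\<integral>\<^sup>+d. \<integral>\<^sup>+x. ennreal (archimedes_density (x, k * x + d)) * indicator {..<c} d
        \<partial>lborel \<partial>lborel)"
    by (intro nn_integral_lborel_swap) measurable
  also have "\<dots> = (\<integral>\<^sup>+d. ennreal (1 / (2 * ?n)) * indicator {- ?n<..<c} d \<partial>lborel)"
  proof (rule nn_integral_cong)
    fix d
    have "(\<integral>\<^sup>+x. ennreal (archimedes_density (x, k * x + d)) * indicator {..<c} d \<partial>lborel)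
      = ennreal (indicator {- ?n<..<?n} d / (2 * ?n)) * indicator {..<c} d"
      by (subst nn_integral_multc) (simp_all add: nn_integral_archimedes_density_line)
    also have "\<dots> = ennreal (1 / (2 * ?n)) * indicator {- ?n<..<c} d"
      using c by (auto simp: indicator_def)
    finally show "(\<integral>\<^sup>+x. ennreal (archimedes_density (x, k * x + d)) * indicator {..<c} d \<partial>lborel)
      = ennreal (1 / (2 * ?n)) * indicator {- ?n<..<c} d" .
  qed
  also have "\<dots> = ennreal (1 / (2 * ?n)) * ennreal (c + ?n)"
    using c by (subst nn_integral_cmult_indicator) (auto simp: abs_less_iff)
  also have "\<dots> = ennreal ((1 + c / ?n) / 2)"
  proof -
    have "0 < ?n" by (simp add: add_pos_nonneg)
    then show ?thesis
      using c by (simp add: abs_less_iff field_simps flip: ennreal_mult)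
  qed
  finally show ?thesis .
qed

text \<open>
  The change of variables from two points to the line through them (slope \<open>k\<close>, intercept \<open>c\<close>)
  and their abscissae; its Jacobian is the difference of the abscissae.
\<close>

lemma nn_integral_line_through_points:
  assumes [measurable]: "case_prod \<Phi> \<in> borel_measurable (borel \<Otimes>\<^sub>M borel)"
  assumes x: "x < x'"
    and [measurable]: "f \<in> borel_measurable borel" "g \<in> borel_measurable borel"
  shows "(\<integral>\<^sup>+y. \<integral>\<^sup>+y'. f y * (g y' * \<Phi> (slope (x, y) (x', y')) (intercept (x, y) (x', y')))
        \<partial>lborel \<partial>lborel)
    = (\<integral>\<^sup>+k. \<integral>\<^sup>+c. f (k * x + c) * (g (k * x' + c) * (ennreal (x' - x) * \<Phi> k c)) \<partial>lborel \<partial>lborel)"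
proof -
  have "(\<integral>\<^sup>+y. \<integral>\<^sup>+y'. f y * (g y' * \<Phi> (slope (x, y) (x', y')) (intercept (x, y) (x', y')))
        \<partial>lborel \<partial>lborel)
    = (\<integral>\<^sup>+y. \<integral>\<^sup>+k. f y * (g (y + (x' - x) * k) * (ennreal (x' - x) * \<Phi> k (y - k * x)))
        \<partial>lborel \<partial>lborel)"
  proof (rule nn_integral_cong)
    fix y
    have "(\<integral>\<^sup>+y'. f y * (g y' * \<Phi> (slope (x, y) (x', y')) (intercept (x, y) (x', y'))) \<partial>lborel)
      = ennreal \<bar>x' - x\<bar> * (\<integral>\<^sup>+k. f y * (g (y + (x' - x) * k) *
        \<Phi> (slope (x, y) (x', y + (x' - x) * k)) (intercept (x, y) (x', y + (x' - x) * k))) \<partial>lborel)"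
      unfolding slope_def intercept_def fst_conv snd_conv
      by (intro nn_integral_real_affine) (measurable, use x in auto)
    also have "\<dots> = (\<integral>\<^sup>+k. ennreal \<bar>x' - x\<bar> * (f y * (g (y + (x' - x) * k) *
        \<Phi> (slope (x, y) (x', y + (x' - x) * k)) (intercept (x, y) (x', y + (x' - x) * k)))) \<partial>lborel)"
      unfolding slope_def intercept_def fst_conv snd_conv
      by (intro nn_integral_cmult [symmetric]) measurable
    also have "\<dots> = (\<integral>\<^sup>+k. f y * (g (y + (x' - x) * k) * (ennreal (x' - x) * \<Phi> k (y - k * x))) \<partial>lborel)"
      using x by (simp add: slope_def intercept_def ac_simps)
    finally show "(\<integral>\<^sup>+y'. f y * (g y' * \<Phi> (slope (x, y) (x', y')) (intercept (x, y) (x', y'))) \<partial>lborel)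
      = (\<integral>\<^sup>+k. f y * (g (y + (x' - x) * k) * (ennreal (x' - x) * \<Phi> k (y - k * x))) \<partial>lborel)" .
  qed
  also have "\<dots> = (\<integral>\<^sup>+k. \<integral>\<^sup>+y. f y * (g (y + (x' - x) * k) * (ennreal (x' - x) * \<Phi> k (y - k * x)))
        \<partial>lborel \<partial>lborel)"
    by (intro nn_integral_lborel_swap) measurable
  also have "\<dots> = (\<integral>\<^sup>+k. \<integral>\<^sup>+c. f (k * x + c) * (g (k * x' + c) * (ennreal (x' - x) * \<Phi> k c))
        \<partial>lborel \<partial>lborel)"
  proof (rule nn_integral_cong)
    fix k
    have "(\<integral>\<^sup>+y. f y * (g (y + (x' - x) * k) * (ennreal (x' - x) * \<Phi> k (y - k * x))) \<partial>lborel)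
      = ennreal \<bar>1\<bar> * (\<integral>\<^sup>+c. f (k * x + 1 * c) * (g (k * x + 1 * c + (x' - x) * k) *
          (ennreal (x' - x) * \<Phi> k (k * x + 1 * c - k * x))) \<partial>lborel)"
      by (intro nn_integral_real_affine) measurable
    also have "\<dots> = (\<integral>\<^sup>+c. f (k * x + c) * (g (k * x' + c) * (ennreal (x' - x) * \<Phi> k c)) \<partial>lborel)"
      by (simp add: algebra_simps)
    finally show "(\<integral>\<^sup>+y. f y * (g (y + (x' - x) * k) * (ennreal (x' - x) * \<Phi> k (y - k * x))) \<partial>lborel)
      = (\<integral>\<^sup>+c. f (k * x + c) * (g (k * x' + c) * (ennreal (x' - x) * \<Phi> k c)) \<partial>lborel)" .
  qed
  finally show ?thesis .
qed

text \<open>\<open>\<Phi>\<close> is a test function of the line. Once the abscissae are innermost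
  they integrate out by \<open>archimedes_density_line_pair\<close>, which leaves the density of
  slope and intercept.\<close>

lemma nn_integral_archimedes_line_law:
  assumes [measurable]: "case_prod \<Phi> \<in> borel_measurable (borel \<Otimes>\<^sub>M borel)"
  shows "(\<integral>\<^sup>+z. \<integral>\<^sup>+z'. ennreal (archimedes_density z) * (ennreal (archimedes_density z') *
        (indicator {fst z<..} (fst z') * \<Phi> (slope z z') (intercept z z'))) \<partial>lborel \<partial>lborel)
    = (\<integral>\<^sup>+k. \<integral>\<^sup>+c. \<Phi> k c * ennreal (indicator {- sqrt (1 + k\<^sup>2)<..<sqrt (1 + k\<^sup>2)} c *
        sqrt (1 - (c / sqrt (1 + k\<^sup>2))\<^sup>2) / (pi\<^sup>2 * sqrt (1 + k\<^sup>2) ^ 3)) \<partial>lborel \<partial>lborel)"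
proof -
  define d where "d x y = ennreal (archimedes_density (x, y))" for x y
  have [measurable]: "case_prod d \<in> borel_measurable (borel \<Otimes>\<^sub>M borel)"
    unfolding d_def by measurable
  define H where "H x x' k c = d x (k * x + c) * (d x' (k * x' + c) *
      (ennreal (indicator {x<..} x' * (x' - x)) * \<Phi> k c))" for x x' k c
  \<comment> \<open>The order of the abscissae enters as a condition on both points, so that joint
    measurability is visible.\<close>
  define F where "F z z' = ennreal (archimedes_density z) * (ennreal (archimedes_density z') *
      ((if fst z < fst z' then 1 else 0) * \<Phi> (slope z z') (intercept z z')))" for z z'
  have [measurable]: "case_prod F \<in> borel_measurable (borel \<Otimes>\<^sub>M borel)"
    unfolding F_def by measurable
  have "(\<integral>\<^sup>+z. \<integral>\<^sup>+z'. ennreal (archimedes_density z) * (ennreal (archimedes_density z') *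
        (indicator {fst z<..} (fst z') * \<Phi> (slope z z') (intercept z z'))) \<partial>lborel \<partial>lborel)
    = (\<integral>\<^sup>+z. \<integral>\<^sup>+z'. F z z' \<partial>lborel \<partial>lborel)"
    by (intro nn_integral_cong) (auto simp: F_def indicator_def)
  also have "\<dots> = (\<integral>\<^sup>+x. \<integral>\<^sup>+y. \<integral>\<^sup>+z'. F (x, y) z' \<partial>lborel \<partial>lborel \<partial>lborel)"
    by (intro nn_integral_lborel_plane) measurable
  also have "\<dots> = (\<integral>\<^sup>+x. \<integral>\<^sup>+y. \<integral>\<^sup>+x'. \<integral>\<^sup>+y'. F (x, y) (x', y') \<partial>lborel \<partial>lborel \<partial>lborel \<partial>lborel)"
    by (intro nn_integral_cong nn_integral_lborel_plane) measurable
  also have "\<dots> = (\<integral>\<^sup>+x. \<integral>\<^sup>+x'. \<integral>\<^sup>+y. \<integral>\<^sup>+y'. F (x, y) (x', y') \<partial>lborel \<partial>lborel \<partial>lborel \<partial>lborel)"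
    by (intro nn_integral_cong nn_integral_lborel_swap) measurable
  also have "\<dots> = (\<integral>\<^sup>+x. \<integral>\<^sup>+x'. \<integral>\<^sup>+k. \<integral>\<^sup>+c. H x x' k c \<partial>lborel \<partial>lborel \<partial>lborel \<partial>lborel)"
  proof (rule nn_integral_cong, rule nn_integral_cong)
    fix x x' :: real
    show "(\<integral>\<^sup>+y. \<integral>\<^sup>+y'. F (x, y) (x', y') \<partial>lborel \<partial>lborel)
      = (\<integral>\<^sup>+k. \<integral>\<^sup>+c. H x x' k c \<partial>lborel \<partial>lborel)"
    proof (cases "x < x'")
      case True
      then show ?thesis
        using nn_integral_line_through_points [of \<Phi> x x' "d x" "d x'"]
        by (simp add: F_def H_def d_def)
    qed (simp add: F_def H_def)
  qed
  \<comment> \<open>Four exchanges carry the integrals over \<open>x\<close> and \<open>x'\<close>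
    inside those over \<open>k\<close> and \<open>c\<close>.\<close>
  also have "\<dots> = (\<integral>\<^sup>+x. \<integral>\<^sup>+k. \<integral>\<^sup>+x'. \<integral>\<^sup>+c. H x x' k c \<partial>lborel \<partial>lborel \<partial>lborel \<partial>lborel)"
    unfolding H_def indicator_def greaterThan_iff
    by (intro nn_integral_cong nn_integral_lborel_swap) measurable
  also have "\<dots> = (\<integral>\<^sup>+x. \<integral>\<^sup>+k. \<integral>\<^sup>+c. \<integral>\<^sup>+x'. H x x' k c \<partial>lborel \<partial>lborel \<partial>lborel \<partial>lborel)"
    unfolding H_def indicator_def greaterThan_iff
    by (intro nn_integral_cong nn_integral_lborel_swap) measurable
  also have "\<dots> = (\<integral>\<^sup>+k. \<integral>\<^sup>+x. \<integral>\<^sup>+c. \<integral>\<^sup>+x'. H x x' k c \<partial>lborel \<partial>lborel \<partial>lborel \<partial>lborel)"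
    unfolding H_def indicator_def greaterThan_iff
    by (intro nn_integral_lborel_swap) measurable
  also have "\<dots> = (\<integral>\<^sup>+k. \<integral>\<^sup>+c. \<integral>\<^sup>+x. \<integral>\<^sup>+x'. H x x' k c \<partial>lborel \<partial>lborel \<partial>lborel \<partial>lborel)"
    unfolding H_def indicator_def greaterThan_iff
    by (intro nn_integral_cong nn_integral_lborel_swap) measurable
  also have "\<dots> = (\<integral>\<^sup>+k. \<integral>\<^sup>+c. \<Phi> k c * ennreal (indicator {- sqrt (1 + k\<^sup>2)<..<sqrt (1 + k\<^sup>2)} c *
        sqrt (1 - (c / sqrt (1 + k\<^sup>2))\<^sup>2) / (pi\<^sup>2 * sqrt (1 + k\<^sup>2) ^ 3)) \<partial>lborel \<partial>lborel)"
  proof (rule nn_integral_cong, rule nn_integral_cong)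
    fix k c :: real
    have "(\<integral>\<^sup>+x. \<integral>\<^sup>+x'. H x x' k c \<partial>lborel \<partial>lborel)
      = (\<integral>\<^sup>+x. \<integral>\<^sup>+x'. \<Phi> k c * (d x (k * x + c) * (d x' (k * x' + c) *
          ennreal (indicator {x<..} x' * (x' - x)))) \<partial>lborel \<partial>lborel)"
      by (simp add: H_def ac_simps)
    also have "\<dots> = (\<integral>\<^sup>+x. \<Phi> k c * (\<integral>\<^sup>+x'. d x (k * x + c) * (d x' (k * x' + c) *
          ennreal (indicator {x<..} x' * (x' - x))) \<partial>lborel) \<partial>lborel)"
      by (intro nn_integral_cong nn_integral_cmult) measurable
    also have "\<dots> = \<Phi> k c * (\<integral>\<^sup>+x. \<integral>\<^sup>+x'. d x (k * x + c) * (d x' (k * x' + c) *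
          ennreal (indicator {x<..} x' * (x' - x))) \<partial>lborel \<partial>lborel)"
      unfolding indicator_def greaterThan_iff
      by (intro nn_integral_cmult) measurable
    also have "(\<integral>\<^sup>+x. \<integral>\<^sup>+x'. d x (k * x + c) * (d x' (k * x' + c) *
          ennreal (indicator {x<..} x' * (x' - x))) \<partial>lborel \<partial>lborel)
      = ennreal (indicator {- sqrt (1 + k\<^sup>2)<..<sqrt (1 + k\<^sup>2)} c *
        sqrt (1 - (c / sqrt (1 + k\<^sup>2))\<^sup>2) / (pi\<^sup>2 * sqrt (1 + k\<^sup>2) ^ 3))"
    proof (cases "\<bar>c\<bar> < sqrt (1 + k\<^sup>2)")
      case True
      then show ?thesis
        using archimedes_density_line_pair [OF True] by (auto simp: d_def abs_less_iff)
    next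
      case False
      then show ?thesis
        by (auto simp: d_def archimedes_density_off_disc abs_less_iff)
    qed
    finally show "(\<integral>\<^sup>+x. \<integral>\<^sup>+x'. H x x' k c \<partial>lborel \<partial>lborel)
      = \<Phi> k c * ennreal (indicator {- sqrt (1 + k\<^sup>2)<..<sqrt (1 + k\<^sup>2)} c *
        sqrt (1 - (c / sqrt (1 + k\<^sup>2))\<^sup>2) / (pi\<^sup>2 * sqrt (1 + k\<^sup>2) ^ 3))" .
  qed
  finally show ?thesis .
qed

section \<open>The semicircle law and half-integer Beta values\<close>

lemma nn_integral_inverse_one_plus_square:
  "(\<integral>\<^sup>+k. ennreal (1 / (1 + k\<^sup>2)) \<partial>lborel) = ennreal pi"
proof -
  have pos: "0 < 1 + k\<^sup>2" for k :: real
    by (simp add: add_pos_nonneg)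
  have half: "(\<integral>\<^sup>+k. ennreal (1 / (1 + k\<^sup>2)) * indicator {0..} k \<partial>lborel) = ennreal (pi / 2 - arctan 0)"
  proof (rule nn_integral_FTC_atLeast)
    show "(arctan has_real_derivative 1 / (1 + k\<^sup>2)) (at k)" for k
      using DERIV_arctan[of k] by (simp add: inverse_eq_divide)
  qed (auto simp: tendsto_arctan_at_top less_imp_le[OF pos])
  have "(\<integral>\<^sup>+k. ennreal (1 / (1 + k\<^sup>2)) * indicator {..<0} k \<partial>lborel)
    = ennreal \<bar>-1\<bar> * (\<integral>\<^sup>+k. ennreal (1 / (1 + (0 + -1 * k)\<^sup>2)) * indicator {..<0} (0 + -1 * k) \<partial>lborel)"
    by (rule nn_integral_real_affine) auto
  also have "\<dots> = (\<integral>\<^sup>+k. ennreal (1 / (1 + k\<^sup>2)) * indicator {0<..} k \<partial>lborel)"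
    by (simp add: indicator_def)
  also have "\<dots> = (\<integral>\<^sup>+k. ennreal (1 / (1 + k\<^sup>2)) * indicator {0..} k \<partial>lborel)"
    using AE_lborel_singleton [of "0 :: real"]
    by (intro nn_integral_cong_AE) (auto simp: indicator_def elim!: eventually_mono)
  finally have "(\<integral>\<^sup>+k. ennreal (1 / (1 + k\<^sup>2)) * indicator {0..} k \<partial>lborel) +
      (\<integral>\<^sup>+k. ennreal (1 / (1 + k\<^sup>2)) * indicator {..<0} k \<partial>lborel) = ennreal pi"
    by (simp add: half flip: ennreal_plus)
  moreover have "(\<integral>\<^sup>+k. ennreal (1 / (1 + k\<^sup>2)) \<partial>lborel) =
      (\<integral>\<^sup>+k. ennreal (1 / (1 + k\<^sup>2)) * indicator {0..} k + ennreal (1 / (1 + k\<^sup>2)) * indicator {..<0} k \<partial>lborel)"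
    by (intro nn_integral_cong) (auto simp: indicator_def)
  ultimately show ?thesis
    by (simp add: nn_integral_add)
qed

text \<open>With \<open>c = n * r\<close> and \<open>n = sqrt (1 + k^2)\<close> the line density
  splits into \<open>1 / (1 + k^2)\<close> and \<open>sqrt (1 - r^2)\<close>, up to
  \<open>1 / pi^2\<close>; the Cauchy factor integrates to \<open>pi\<close>. For
  \<open>\<phi> = 1\<close> the value is 1/2, the chance that the first point lies to the left of
  the second.\<close>

lemma nn_integral_archimedes_line_distance:
  assumes [measurable]: "\<phi> \<in> borel_measurable borel"
  shows "(\<integral>\<^sup>+z. \<integral>\<^sup>+z'. ennreal (archimedes_density z) * (ennreal (archimedes_density z') *
        (indicator {fst z<..} (fst z') * \<phi> (intercept z z' / sqrt (1 + (slope z z')\<^sup>2)))) \<partial>lborel \<partial>lborel)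
    = ennreal (1 / pi) * (\<integral>\<^sup>+r. \<phi> r * ennreal (indicator {-1<..<1} r * sqrt (1 - r\<^sup>2)) \<partial>lborel)"
proof -
  let ?w = "\<lambda>r. indicator {-1<..<1} r * sqrt (1 - r\<^sup>2) :: real"
  let ?I = "\<integral>\<^sup>+r. \<phi> r * ennreal (?w r) \<partial>lborel"
  have "(\<integral>\<^sup>+z. \<integral>\<^sup>+z'. ennreal (archimedes_density z) * (ennreal (archimedes_density z') *
        (indicator {fst z<..} (fst z') * \<phi> (intercept z z' / sqrt (1 + (slope z z')\<^sup>2)))) \<partial>lborel \<partial>lborel)
    = (\<integral>\<^sup>+k. \<integral>\<^sup>+c. \<phi> (c / sqrt (1 + k\<^sup>2)) * ennreal (indicator {- sqrt (1 + k\<^sup>2)<..<sqrt (1 + k\<^sup>2)} c *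
        sqrt (1 - (c / sqrt (1 + k\<^sup>2))\<^sup>2) / (pi\<^sup>2 * sqrt (1 + k\<^sup>2) ^ 3)) \<partial>lborel \<partial>lborel)"
    using nn_integral_archimedes_line_law [of "\<lambda>k c. \<phi> (c / sqrt (1 + k\<^sup>2))"] by simp
  also have "\<dots> = (\<integral>\<^sup>+k. ennreal (1 / pi\<^sup>2) * ennreal (1 / (1 + k\<^sup>2)) * ?I \<partial>lborel)"
  proof (rule nn_integral_cong)
    fix k :: real
    let ?n = "sqrt (1 + k\<^sup>2)"
    have pos_k: "0 \<le> 1 + k\<^sup>2" by simp
    have n: "0 < ?n" "?n\<^sup>2 = 1 + k\<^sup>2" by (auto simp: add_pos_nonneg)
    have "(\<integral>\<^sup>+c. \<phi> (c / ?n) * ennreal (indicator {- ?n<..<?n} c *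
        sqrt (1 - (c / ?n)\<^sup>2) / (pi\<^sup>2 * ?n ^ 3)) \<partial>lborel)
      = ennreal \<bar>?n\<bar> * (\<integral>\<^sup>+r. \<phi> ((0 + ?n * r) / ?n) * ennreal (indicator {- ?n<..<?n} (0 + ?n * r) *
        sqrt (1 - ((0 + ?n * r) / ?n)\<^sup>2) / (pi\<^sup>2 * ?n ^ 3)) \<partial>lborel)"
      using n by (intro nn_integral_real_affine) auto
    also have "\<dots> = (\<integral>\<^sup>+r. ennreal \<bar>?n\<bar> * (\<phi> ((0 + ?n * r) / ?n) * ennreal (indicator {- ?n<..<?n} (0 + ?n * r) *
        sqrt (1 - ((0 + ?n * r) / ?n)\<^sup>2) / (pi\<^sup>2 * ?n ^ 3))) \<partial>lborel)"
      by (intro nn_integral_cmult [symmetric]) measurable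
    also have "\<dots> = (\<integral>\<^sup>+r. ennreal (1 / pi\<^sup>2) * ennreal (1 / (1 + k\<^sup>2)) * (\<phi> r * ennreal (?w r)) \<partial>lborel)"
    proof (rule nn_integral_cong)
      fix r
      have i: "indicator {- ?n<..<?n} (?n * r) = (indicator {-1<..<1} r :: real)"
        using n(1) mult_less_cancel_left_pos[of ?n "-1" r] mult_less_cancel_left_pos[of ?n r 1]
        by (auto simp: indicator_def)
      have e: "0 + ?n * r = ?n * r" "?n * r / ?n = r" "\<bar>?n\<bar> = ?n"
        using n(1) by auto
      have w: "0 \<le> ?w r"
        using square_less_one_iff[of r] by (auto simp: indicator_def)
      have *: "x * (v / (P * x ^ 3)) = 1 / P * (1 / x\<^sup>2) * v" if "0 < x" "0 < P" for x v P :: real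
        using that by (simp add: field_simps power2_eq_square power3_eq_cube)
      have "?n * (?w r / (pi\<^sup>2 * ?n ^ 3)) = 1 / pi\<^sup>2 * (1 / ?n\<^sup>2) * ?w r"
        by (rule *) (use n(1) in auto)
      then have "ennreal ?n * ennreal (?w r / (pi\<^sup>2 * ?n ^ 3)) =
          ennreal (1 / pi\<^sup>2) * ennreal (1 / (1 + k\<^sup>2)) * ennreal (?w r)"
        unfolding n(2) using n(1) by (metis ennreal_mult' divide_nonneg_nonneg less_imp_le
            mult_nonneg_nonneg pos_k zero_le_one zero_le_power2)
      then show "ennreal \<bar>?n\<bar> * (\<phi> ((0 + ?n * r) / ?n) * ennreal (indicator {- ?n<..<?n} (0 + ?n * r) *
        sqrt (1 - ((0 + ?n * r) / ?n)\<^sup>2) / (pi\<^sup>2 * ?n ^ 3))) =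
        ennreal (1 / pi\<^sup>2) * ennreal (1 / (1 + k\<^sup>2)) * (\<phi> r * ennreal (?w r))"
        unfolding e i by (simp only: ac_simps)
    qed
    also have "\<dots> = ennreal (1 / pi\<^sup>2) * ennreal (1 / (1 + k\<^sup>2)) * ?I"
      by (intro nn_integral_cmult) measurable
    finally show "(\<integral>\<^sup>+c. \<phi> (c / ?n) * ennreal (indicator {- ?n<..<?n} c *
        sqrt (1 - (c / ?n)\<^sup>2) / (pi\<^sup>2 * ?n ^ 3)) \<partial>lborel)
      = ennreal (1 / pi\<^sup>2) * ennreal (1 / (1 + k\<^sup>2)) * ?I" .
  qed
  also have "\<dots> = ennreal (1 / pi\<^sup>2) * ennreal pi * ?I"
    by (subst nn_integral_multc, simp, subst nn_integral_cmult, simp)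
      (simp only: nn_integral_inverse_one_plus_square)
  also have "ennreal (1 / pi\<^sup>2) * ennreal pi = ennreal (1 / pi)"
    by (simp add: power2_eq_square flip: ennreal_mult)
  finally show ?thesis .
qed

text \<open>Substitute the probability \<open>p = (1 + r) / 2\<close> of lying below the line:
  \<open>dr = 2 dp\<close> and \<open>sqrt (1 - r^2) = 2 * sqrt (p * (1 - p))\<close> give the
  factor 4, and the square roots raise both exponents by 1/2.\<close>

lemma nn_integral_semicircle_Beta:
  "(\<integral>\<^sup>+r. ennreal (((1 + r) / 2) ^ a * (1 - (1 + r) / 2) ^ b) *
      ennreal (indicator {-1<..<1} r * sqrt (1 - r\<^sup>2)) \<partial>lborel)
    = ennreal (4 * Beta (real a + 3 / 2) (real b + 3 / 2))"
proof -
  let ?h = "\<lambda>p. p powr (real a + 3 / 2 - 1) * (1 - p) powr (real b + 3 / 2 - 1)"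
  have "(?h has_integral Beta (real a + 3 / 2) (real b + 3 / 2)) {0<..<1}"
    using has_integral_Beta_real [of "real a + 3 / 2" "real b + 3 / 2"]
    by (simp add: has_integral_Icc_iff_Ioo)
  then have B: "(\<integral>\<^sup>+p. ennreal (?h p) * indicator {0<..<1} p \<partial>lborel)
      = ennreal (Beta (real a + 3 / 2) (real b + 3 / 2))"
    by (intro nn_integral_has_integral_lebesgue') auto
  have "(\<integral>\<^sup>+r. ennreal (((1 + r) / 2) ^ a * (1 - (1 + r) / 2) ^ b) *
      ennreal (indicator {-1<..<1} r * sqrt (1 - r\<^sup>2)) \<partial>lborel)
    = ennreal \<bar>2\<bar> * (\<integral>\<^sup>+p. ennreal (((1 + (-1 + 2 * p)) / 2) ^ a * (1 - (1 + (-1 + 2 * p)) / 2) ^ b) *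
      ennreal (indicator {-1<..<1} (-1 + 2 * p) * sqrt (1 - (-1 + 2 * p)\<^sup>2)) \<partial>lborel)"
    by (intro nn_integral_real_affine) auto
  also have "\<dots> = ennreal 2 * (\<integral>\<^sup>+p. ennreal 2 * (ennreal (?h p) * indicator {0<..<1} p) \<partial>lborel)"
  proof -
    have "ennreal (((1 + (-1 + 2 * p)) / 2) ^ a * (1 - (1 + (-1 + 2 * p)) / 2) ^ b) *
      ennreal (indicator {-1<..<1} (-1 + 2 * p) * sqrt (1 - (-1 + 2 * p)\<^sup>2)) =
      ennreal 2 * (ennreal (?h p) * indicator {0<..<1} p)" for p :: real
    proof (cases "0 < p \<and> p < 1")
      case True
      then have p: "0 < p" "0 < 1 - p" by auto
      have "1 - (-1 + 2 * p)\<^sup>2 = 2\<^sup>2 * (p * (1 - p))"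
        by algebra
      then have s: "sqrt (1 - (-1 + 2 * p)\<^sup>2) = 2 * (sqrt p * sqrt (1 - p))"
        by (simp add: real_sqrt_mult)
      have h: "q powr (real n + 3 / 2 - 1) = q ^ n * sqrt q" if "0 < q" for q :: real and n
        using that by (simp add: powr_add powr_realpow powr_half_sqrt add.commute flip: add_divide_distrib)
      have i: "indicator {-1<..<1} (-1 + 2 * p) = (1 :: real)"
        "indicator {0<..<1} p = (1 :: ennreal)" "(1 + (-1 + 2 * p)) / 2 = p"
        using True by auto
      have "ennreal (p ^ a * (1 - p) ^ b) * ennreal (1 * (2 * (sqrt p * sqrt (1 - p))))
        = ennreal (2 * (p ^ a * sqrt p * ((1 - p) ^ b * sqrt (1 - p))))"
        using p by (subst ennreal_mult [symmetric]) (auto simp: ac_simps)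
      also have "\<dots> = ennreal 2 * (ennreal (p ^ a * sqrt p * ((1 - p) ^ b * sqrt (1 - p))) * 1)"
        using p by (subst ennreal_mult) auto
      finally show ?thesis
        unfolding i s h [OF p(1)] h [OF p(2)] .
    qed (auto simp: indicator_def)
    then show ?thesis by simp
  qed
  also have "\<dots> = ennreal 2 * (ennreal 2 * ennreal (Beta (real a + 3 / 2) (real b + 3 / 2)))"
    by (subst nn_integral_cmult, measurable) (simp only: B)
  also have "\<dots> = ennreal (4 * Beta (real a + 3 / 2) (real b + 3 / 2))"
    by (simp add: mult.assoc[symmetric] ennreal_mult')
  finally show ?thesis .
qed

text \<open>The functional equation of Gamma peels off the factors from \<open>n + 1 / 2\<close>
  down to \<open>3 / 2\<close> and stops at \<open>Gamma (3 / 2) = sqrt pi / 2\<close>. The falling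
  factorials of the final formula originate here.\<close>

lemma Gamma_plus_half:
  "Gamma (real (Suc n) + 1 / 2) = falling_factorial (real (Suc n) - 1 / 2) n * (sqrt pi / 2)"
proof (induction n)
  case 0
  have half: "(1 / 2 :: real) \<notin> \<int>\<^sub>\<le>\<^sub>0"
    by (auto dest: nonpos_Ints_nonpos)
  show ?case
    using Gamma_plus1 [of "1 / 2 :: real"] half
    by (simp add: falling_factorial_def Gamma_one_half_real add.commute)
next
  case (Suc n)
  have ff: "falling_factorial (a + 1) (Suc n) = (a + 1) * falling_factorial a n" for a
    unfolding falling_factorial_def by (subst prod.lessThan_Suc_shift) simp
  have "Gamma (real (Suc (Suc n)) + 1 / 2) = (real (Suc n) + 1 / 2) * Gamma (real (Suc n) + 1 / 2)"
    using Gamma_plus1 [of "real (Suc n) + 1 / 2"]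
    by (simp add: nonpos_Ints_def add_ac)
  then show ?case
    using Suc ff [of "real (Suc n) - 1 / 2"] by (simp add: add_ac)
qed

text \<open>The two factors \<open>sqrt pi / 2\<close> cancel \<open>4 / pi\<close>, and the
  factorial on the left cancels the denominator \<open>Gamma (a + b + 3)\<close> of Beta.\<close>

lemma Beta_half_integers:
  "4 / pi * Beta (real a + 3 / 2) (real b + 3 / 2) * fact (a + b + 2)
    = falling_factorial (real a + 1 / 2) a * falling_factorial (real b + 1 / 2) b"
proof -
  have 1: "Gamma (real a + 3 / 2 + (real b + 3 / 2)) = (fact (a + b + 2) :: real)"
    using Gamma_fact [of "a + b + 2", where ?'a = real] by (simp add: add_ac)
  have 2: "Gamma (real n + 3 / 2) = falling_factorial (real n + 1 / 2) n * (sqrt pi / 2)" for n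
    using Gamma_plus_half [of n] by (simp add: add_ac)
  have 3: "4 / pi * (x * (sqrt pi / 2) * (y * (sqrt pi / 2)) / z) * z = x * y"
    if "z \<noteq> 0" for x y z :: real
  proof -
    have "4 / (s * s) * (x * (s / 2) * (y * (s / 2)) / z) * z = x * y" if "0 < s" for s
      using that \<open>z \<noteq> 0\<close> by simp
    from this [of "sqrt pi"] show ?thesis by simp
  qed
  show ?thesis
    unfolding Beta_def 1 2 by (rule 3) simp
qed

subsection \<open>Random point configurations\<close>

definition archimedes_measure :: "(real \<times> real) measure" where
  "archimedes_measure = density lborel (\<lambda>z. ennreal (archimedes_density z))"

lemma sets_archimedes_measure [simp, measurable_cong]: "sets archimedes_measure = sets borel"
  by (simp add: archimedes_measure_def)

lemma space_archimedes_measure [simp]: "space archimedes_measure = UNIV"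
  by (simp add: archimedes_measure_def)

section \<open>Counts and null sets in product spaces\<close>

text \<open>The event splits by the exact set \<open>S\<close> of indices whose coordinates fall
  into \<open>B\<close>; each piece is a product set, and all pieces have the same measure.\<close>

lemma (in prob_space) emeasure_PiM_card_eq_binomial:
  assumes J: "finite J" and B: "B \<in> sets M"
  shows "{\<omega> \<in> space (Pi\<^sub>M J (\<lambda>_. M)). card {c\<in>J. \<omega> c \<in> B} = n} \<in> sets (Pi\<^sub>M J (\<lambda>_. M))"
    and "emeasure (Pi\<^sub>M J (\<lambda>_. M)) {\<omega> \<in> space (Pi\<^sub>M J (\<lambda>_. M)). card {c\<in>J. \<omega> c \<in> B} = n}
    = ennreal (real (card J choose n) * prob B ^ n * (1 - prob B) ^ (card J - n))"
proof -
  interpret product_sigma_finite "\<lambda>_. M"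
    by standard
  let ?P = "Pi\<^sub>M J (\<lambda>_. M)"
  define A where "A S = (\<Pi>\<^sub>E c\<in>J. if c \<in> S then B else space M - B)" for S
  let ?S = "{S. S \<subseteq> J \<and> card S = n}"
  have fin: "finite ?S"
    by (rule finite_subset[of _ "Pow J"]) (use J in auto)
  have setA: "A S \<in> sets ?P" for S
    unfolding A_def using B J by (intro sets_PiM_I_finite) auto
  have A_iff: "\<omega> \<in> A S \<longleftrightarrow> \<omega> \<in> space ?P \<and> {c\<in>J. \<omega> c \<in> B} = S" if "S \<subseteq> J" for \<omega> S
    using that sets.sets_into_space[OF B]
    unfolding A_def space_PiM PiE_iff by (auto split: if_splits)
  have eq: "{\<omega> \<in> space ?P. card {c\<in>J. \<omega> c \<in> B} = n} = (\<Union>S\<in>?S. A S)"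
    (is "?L = ?R")
  proof (intro equalityI subsetI)
    fix \<omega> assume "\<omega> \<in> ?L"
    then have "{c\<in>J. \<omega> c \<in> B} \<in> ?S" "\<omega> \<in> A {c\<in>J. \<omega> c \<in> B}"
      using A_iff [of "{c\<in>J. \<omega> c \<in> B}" \<omega>] by auto
    then show "\<omega> \<in> ?R" by blast
  next
    fix \<omega> assume "\<omega> \<in> ?R"
    then obtain S where "S \<subseteq> J" "card S = n" "\<omega> \<in> A S" by auto
    then show "\<omega> \<in> ?L"
      using A_iff [of S \<omega>] by simp
  qed
  have disj: "disjoint_family_on A ?S"
    unfolding disjoint_family_on_def
  proof (intro ballI impI, rule ccontr)
    fix S T assume ST: "S \<in> ?S" "T \<in> ?S" "S \<noteq> T" and "A S \<inter> A T \<noteq> {}"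
    then obtain \<omega> where "\<omega> \<in> A S" "\<omega> \<in> A T" by blast
    then have "{c\<in>J. \<omega> c \<in> B} = S" "{c\<in>J. \<omega> c \<in> B} = T"
      using ST A_iff [of S \<omega>] A_iff [of T \<omega>] by auto
    then show False using ST by simp
  qed
  have each: "emeasure ?P (A S) = ennreal (prob B ^ n * (1 - prob B) ^ (card J - n))" if S: "S \<in> ?S" for S
  proof -
    have finS: "finite S" using S J finite_subset by auto
    have "emeasure ?P (A S) = (\<Prod>c\<in>J. emeasure M (if c \<in> S then B else space M - B))"
      unfolding A_def using B J by (intro emeasure_PiM) auto
    also have "\<dots> = (\<Prod>c\<in>J. ennreal (if c \<in> S then prob B else 1 - prob B))"
      using B by (intro prod.cong) (auto simp: emeasure_eq_measure prob_compl)
    also have "\<dots> = ennreal (\<Prod>c\<in>J. if c \<in> S then prob B else 1 - prob B)"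
      by (intro prod_ennreal) auto
    also have "(\<Prod>c\<in>J. if c \<in> S then prob B else 1 - prob B)
        = (\<Prod>c\<in>J \<inter> S. prob B) * (\<Prod>c\<in>J - S. 1 - prob B)"
      using J by (subst prod.If_cases) (auto simp: Diff_eq)
    also have "\<dots> = prob B ^ n * (1 - prob B) ^ (card J - n)"
      using S J finS by (auto simp: Int_absorb1 card_Diff_subset)
    finally show ?thesis .
  qed
  have "emeasure ?P (\<Union>S\<in>?S. A S) = (\<Sum>S\<in>?S. emeasure ?P (A S))"
    using fin disj setA by (intro sum_emeasure [symmetric]) auto
  also have "\<dots> = (\<Sum>S\<in>?S. ennreal (prob B ^ n * (1 - prob B) ^ (card J - n)))"
    using each by (intro sum.cong) auto
  also have "\<dots> = ennreal (real (card J choose n) * prob B ^ n * (1 - prob B) ^ (card J - n))"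
    using n_subsets[OF J, of n]
    by (simp add: ennreal_of_nat_eq_real_of_nat mult.assoc flip: ennreal_mult)
  finally show "emeasure ?P {\<omega> \<in> space ?P. card {c\<in>J. \<omega> c \<in> B} = n}
    = ennreal (real (card J choose n) * prob B ^ n * (1 - prob B) ^ (card J - n))"
    unfolding eq .
  show "{\<omega> \<in> space ?P. card {c\<in>J. \<omega> c \<in> B} = n} \<in> sets ?P"
    unfolding eq using fin setA by (rule sets.finite_UN)
qed

text \<open>By Fubini a degeneracy of the whole family can be shown to be null by freezing all
  points but one.\<close>

lemma (in prob_space) AE_PiM_if_AE_component:
  assumes I: "finite I" "i \<in> I" and Q: "Measurable.pred (Pi\<^sub>M I (\<lambda>_. M)) Q"
    and AE: "\<And>x. x \<in> space (Pi\<^sub>M (I - {i}) (\<lambda>_. M)) \<Longrightarrow> AE z in M. Q (x(i := z))"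
  shows "AE \<omega> in Pi\<^sub>M I (\<lambda>_. M). Q \<omega>"
proof -
  interpret product_sigma_finite "\<lambda>_. M"
    by standard
  define J where "J = I - {i}"
  have J: "finite J" "i \<notin> J" "I = insert i J" using I by (auto simp: J_def)
  let ?P = "Pi\<^sub>M (insert i J) (\<lambda>_. M)"
  have [measurable]: "Measurable.pred ?P Q" using Q J by simp
  have m: "(\<lambda>\<omega>. if Q \<omega> then 0 else 1 :: ennreal) \<in> borel_measurable ?P" by measurable
  have "(\<integral>\<^sup>+\<omega>. (if Q \<omega> then 0 else 1 :: ennreal) \<partial>?P) =
      (\<integral>\<^sup>+x. \<integral>\<^sup>+z. (if Q (x(i := z)) then 0 else 1) \<partial>M \<partial>Pi\<^sub>M J (\<lambda>_. M))"
    by (rule product_nn_integral_insert[OF J(1,2) m])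
  also have "\<dots> = (\<integral>\<^sup>+x. 0 \<partial>Pi\<^sub>M J (\<lambda>_. M))"
  proof (rule nn_integral_cong)
    fix x assume "x \<in> space (Pi\<^sub>M J (\<lambda>_. M))"
    then have "AE z in M. Q (x(i := z))"
      using AE by (simp add: J_def)
    then have "(\<integral>\<^sup>+z. (if Q (x(i := z)) then 0 else 1) \<partial>M) = (\<integral>\<^sup>+z. 0 \<partial>M)"
      by (intro nn_integral_cong_AE) (auto elim!: eventually_mono)
    then show "(\<integral>\<^sup>+z. (if Q (x(i := z)) then 0 else 1) \<partial>M) = 0" by simp
  qed
  finally have "AE \<omega> in ?P. (if Q \<omega> then 0 else 1 :: ennreal) = 0"
    using m by (simp add: nn_integral_0_iff_AE)
  then show ?thesis
    unfolding J(3) by (auto elim!: eventually_mono split: if_splits)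
qed

lemma AE_archimedes_measure_hyperplane:
  assumes "v \<noteq> 0"
  shows "AE z in archimedes_measure. v \<bullet> z \<noteq> w"
proof -
  have "{z. v \<bullet> z = w} \<in> null_sets lebesgue"
    using negligible_hyperplane[of v w] assms by (simp add: negligible_iff_null_sets)
  moreover have "{z. v \<bullet> z = w} \<in> sets lborel"
    by (simp add: closed_hyperplane)
  ultimately have "{z. v \<bullet> z = w} \<in> null_sets lborel"
    using null_sets_completion_iff by blast
  then have "AE z in lborel. v \<bullet> z \<noteq> w"
    by (auto dest: AE_not_in)
  then show ?thesis
    unfolding archimedes_measure_def by (subst AE_density) (auto elim!: eventually_mono)
qed

section \<open>General position holds almost surely\<close>

definition cross_product :: "real \<times> real \<Rightarrow> real \<times> real \<Rightarrow> real" where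
  "cross_product u v = fst u * snd v - snd u * fst v"

lemma borel_measurable_cross_product [measurable]:
  "(\<lambda>(u, v). cross_product u v) \<in> borel_measurable (borel \<Otimes>\<^sub>M borel)"
  unfolding cross_product_def by measurable

text \<open>Proportionality becomes the vanishing of a polynomial, which is visibly measurable. The
  collinearity clause is absorbed: three collinear points give proportional differences for two
  distinct pairs with a common point.\<close>

lemma general_position_iff:
  "general_position m p \<longleftrightarrow>
    (\<forall>a\<in>{1..m}. \<forall>b\<in>{1..m}. a \<noteq> b \<longrightarrow> fst (p a) \<noteq> fst (p b)) \<and>
    (\<forall>a\<in>{1..m}. \<forall>b\<in>{1..m}. \<forall>c\<in>{1..m}. \<forall>d\<in>{1..m}.
       a \<noteq> b \<and> c \<noteq> d \<and> {a, b} \<noteq> {c, d} \<longrightarrow> cross_product (p b - p a) (p d - p c) \<noteq> 0)"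
  (is "_ \<longleftrightarrow> ?X \<and> ?C")
proof
  assume gp: "general_position m p"
  then have X: ?X
    by (simp add: general_position_def)
  moreover have ?C
  proof (intro ballI impI notI)
    fix a b c d
    assume in_m: "a \<in> {1..m}" "b \<in> {1..m}" "c \<in> {1..m}" "d \<in> {1..m}"
      and ne: "a \<noteq> b \<and> c \<noteq> d \<and> {a, b} \<noteq> {c, d}"
      and 0: "cross_product (p b - p a) (p d - p c) = 0"
    have x: "fst (p d) - fst (p c) \<noteq> 0"
      using X in_m ne by fastforce
    \<comment> \<open>The scalar is read off from the abscissae; the vanishing cross product makes
      it fit the ordinates too.\<close>
    have "p b - p a = ((fst (p b) - fst (p a)) / (fst (p d) - fst (p c))) *\<^sub>R (p d - p c)"
    proof (rule prod_eqI)
      have "w = u / y * v" if "u * v = w * y" "y \<noteq> 0" for u v w y :: real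
        using that by (simp add: field_simps)
      from this [OF 0 [unfolded cross_product_def, simplified] x]
      show "snd (p b - p a) = snd (((fst (p b) - fst (p a)) / (fst (p d) - fst (p c))) *\<^sub>R (p d - p c))"
        by simp
    qed (use x in simp)
    then show False
      using gp in_m ne unfolding general_position_def by blast
  qed
  ultimately show "?X \<and> ?C" by blast
next
  assume XC: "?X \<and> ?C"
  have "\<not> collinear {p a, p b, p c}"
    if in_m: "a \<in> {1..m}" "b \<in> {1..m}" "c \<in> {1..m}" and ne: "a \<noteq> b" "b \<noteq> c" "a \<noteq> c" for a b c
  proof
    assume "collinear {p a, p b, p c}"
    then obtain u where u: "\<forall>x\<in>{p a, p b, p c}. \<forall>y\<in>{p a, p b, p c}. \<exists>r. x - y = r *\<^sub>R u"
      unfolding collinear_def by blast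
    obtain r s where "p b - p a = r *\<^sub>R u" "p c - p a = s *\<^sub>R u"
      using u by (metis insertI1 insertI2)
    then have "cross_product (p b - p a) (p c - p a) = 0"
      by (simp add: cross_product_def)
    moreover have "{a, b} \<noteq> {a, c}" using ne by (auto simp: doubleton_eq_iff)
    ultimately show False
      using XC in_m ne by blast
  qed
  moreover have "\<not> (\<exists>r. p b - p a = r *\<^sub>R (p d - p c))"
    if "a \<in> {1..m}" "b \<in> {1..m}" "c \<in> {1..m}" "d \<in> {1..m}"
      "a \<noteq> b \<and> c \<noteq> d \<and> {a, b} \<noteq> {c, d}" for a b c d
  proof
    assume "\<exists>r. p b - p a = r *\<^sub>R (p d - p c)"
    then obtain r where r: "p b - p a = r *\<^sub>R (p d - p c)" ..
    have "cross_product (p b - p a) (p d - p c) = 0"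
      unfolding r by (simp add: cross_product_def)
    then show False using XC that by blast
  qed
  ultimately show "general_position m p"
    using conjunct1 [OF XC] unfolding general_position_def by (intro conjI ballI impI) simp_all
qed

lemma measurable_component_fst:
  assumes "a \<in> I"
  shows "(\<lambda>p. fst (p a :: real \<times> real)) \<in> borel_measurable (Pi\<^sub>M I (\<lambda>_. borel))"
  by (rule measurable_compose [OF measurable_component_singleton [OF assms] borel_measurable_fst_snd_real(1)])

lemma pred_fst_eq:
  assumes "a \<in> I" "b \<in> I"
  shows "Measurable.pred (Pi\<^sub>M I (\<lambda>_. borel)) (\<lambda>p. fst (p a :: real \<times> real) = fst (p b))"
  unfolding pred_def by (intro borel_measurable_eq measurable_component_fst assms)

lemma pred_cross_product_eq_0:
  assumes "a \<in> I" "b \<in> I" "c \<in> I" "d \<in> I"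
  shows "Measurable.pred (Pi\<^sub>M I (\<lambda>_. borel)) (\<lambda>p. cross_product (p b - p a) (p d - p c) = 0)"
proof -
  note [measurable] = assms [THEN measurable_component_singleton [where M = "\<lambda>_. borel"]]
  show ?thesis by measurable
qed

lemma pred_general_position [measurable]:
  "Measurable.pred (Pi\<^sub>M {1..m} (\<lambda>_. borel)) (general_position m)"
  unfolding general_position_iff
  by (intro pred_intros_logic(2-5) pred_intros_finite(3) finite_atLeastAtMost
      pred_fst_eq pred_cross_product_eq_0) simp_all

lemma AE_general_position:
  assumes "prob_space archimedes_measure"
  shows "AE p in Pi\<^sub>M {1..m} (\<lambda>_. archimedes_measure). general_position m p"
proof -
  interpret prob_space archimedes_measure by fact
  let ?P = "Pi\<^sub>M {1..m} (\<lambda>_. archimedes_measure)"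
  have sets_P: "measurable ?P N = measurable (Pi\<^sub>M {1..m} (\<lambda>_. borel)) N" for N :: "bool measure"
    by (intro measurable_cong_sets sets_PiM_cong) simp_all
  have X: "AE p in ?P. fst (p a) \<noteq> fst (p b)" if ab: "a \<in> {1..m}" "b \<in> {1..m}" "a \<noteq> b" for a b
  proof (rule AE_PiM_if_AE_component[of _ b])
    show "Measurable.pred ?P (\<lambda>p. fst (p a) \<noteq> fst (p b))"
      using ab unfolding sets_P by (intro pred_intros_logic(2) pred_fst_eq)
    fix x assume "x \<in> space (Pi\<^sub>M ({1..m} - {b}) (\<lambda>_. archimedes_measure))"
    show "AE z in archimedes_measure. fst ((x(b := z)) a) \<noteq> fst ((x(b := z)) b)"
      using AE_archimedes_measure_hyperplane[of "(1, 0)" "fst (x a)"] ab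
      by (auto simp: inner_prod_def zero_prod_def elim!: eventually_mono)
  qed (use ab in auto)
  \<comment> \<open>Since \<open>b\<close> is not in \<open>{c, d}\<close>, the cross product is
    affine in the point with index \<open>b\<close> when all other points are frozen.\<close>
  have C1: "AE p in ?P. cross_product (p b - p a) (p d - p c) \<noteq> 0"
    if in_m: "a \<in> {1..m}" "b \<in> {1..m}" "c \<in> {1..m}" "d \<in> {1..m}" and
      ne: "a \<noteq> b" "c \<noteq> d" "b \<notin> {c, d}" for a b c d
  proof -
    \<comment> \<open>The premise makes the normal vector of the exceptional line nonzero;
      \<open>X\<close> discharges it almost surely.\<close>
    have "AE p in ?P. fst (p d) \<noteq> fst (p c) \<longrightarrow> cross_product (p b - p a) (p d - p c) \<noteq> 0"
    proof (rule AE_PiM_if_AE_component[of _ b])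
      show "Measurable.pred ?P (\<lambda>p. fst (p d) \<noteq> fst (p c) \<longrightarrow> cross_product (p b - p a) (p d - p c) \<noteq> 0)"
        using in_m unfolding sets_P
        by (intro pred_intros_logic(2-5) pred_fst_eq pred_cross_product_eq_0)
      fix x assume "x \<in> space (Pi\<^sub>M ({1..m} - {b}) (\<lambda>_. archimedes_measure))"
      let ?v = "x d - x c"
      show "AE z in archimedes_measure. fst ((x(b := z)) d) \<noteq> fst ((x(b := z)) c) \<longrightarrow>
          cross_product ((x(b := z)) b - (x(b := z)) a) ((x(b := z)) d - (x(b := z)) c) \<noteq> 0"
      proof (cases "fst (x d) = fst (x c)")
        case True
        then show ?thesis using ne by simp
      next
        case False
        then have "(snd ?v, - fst ?v) \<noteq> 0"
          by (simp add: zero_prod_def)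
        from AE_archimedes_measure_hyperplane[OF this, of "(snd ?v, - fst ?v) \<bullet> x a"] show ?thesis
          by eventually_elim
            (use ne in \<open>auto simp: inner_prod_def cross_product_def algebra_simps\<close>)
      qed
    qed (use in_m in auto)
    then show ?thesis
      using X[of d c] in_m ne by (auto elim: eventually_elim2)
  qed
  have C: "AE p in ?P. cross_product (p b - p a) (p d - p c) \<noteq> 0"
    if in_m: "a \<in> {1..m}" "b \<in> {1..m}" "c \<in> {1..m}" "d \<in> {1..m}" and
      ne: "a \<noteq> b \<and> c \<noteq> d \<and> {a, b} \<noteq> {c, d}" for a b c d
  proof (cases "b \<in> {c, d}")
    case False
    then show ?thesis using C1[of a b c d] in_m ne by simp
  next
    case True
    \<comment> \<open>Otherwise both pairs would coincide. So \<open>a\<close> and \<open>b\<close>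
      can change roles, which only flips the sign of the cross product.\<close>
    then have "a \<notin> {c, d}" using ne by auto
    then have "AE p in ?P. cross_product (p a - p b) (p d - p c) \<noteq> 0"
      using C1[of b a c d] in_m ne by simp
    then show ?thesis
      by eventually_elim (auto simp: cross_product_def algebra_simps)
  qed
  show ?thesis
    unfolding general_position_iff
    by (intro AE_conjI AE_finite_allI AE_impI finite_atLeastAtMost)
      (use X C in auto)
qed

section \<open>The expected number of pairs with a given number of points below\<close>

definition below_count :: "nat set \<Rightarrow> (nat \<Rightarrow> real \<times> real) \<Rightarrow> nat \<Rightarrow> nat \<Rightarrow> nat" where
  "below_count I p a b =
     card {c \<in> I - {a, b}. p c \<in> below_line (slope (p a) (p b)) (intercept (p a) (p b))}"

text \<open>Comparing abscissae selects one orientation of each unordered pair without reference to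
  the sorted labelling.\<close>

definition pairs_above :: "nat set \<Rightarrow> nat \<Rightarrow> (nat \<Rightarrow> real \<times> real) \<Rightarrow> (nat \<times> nat) set" where
  "pairs_above I n p =
     {(a, b). a \<in> I \<and> b \<in> I \<and> fst (p a) < fst (p b) \<and> below_count I p a b = n}"

lemma pred_pairs_above:
  assumes ab: "a \<in> I" "b \<in> I"
  shows "Measurable.pred (Pi\<^sub>M I (\<lambda>_. borel)) (\<lambda>p. (a, b) \<in> pairs_above I n p)"
proof -
  let ?P = "Pi\<^sub>M I (\<lambda>_. borel :: (real \<times> real) measure)"
  have c: "{p \<in> space ?P. c \<in> {c \<in> I - {a, b}. p c \<in> below_line (slope (p a) (p b)) (intercept (p a) (p b))}}
      \<in> sets ?P" for c
  proof (cases "c \<in> I - {a, b}")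
    case True
    then have "c \<in> I" by simp
    note [measurable] = ab [THEN measurable_component_singleton [where M = "\<lambda>_. borel"]]
      measurable_component_singleton [OF \<open>c \<in> I\<close>, where M = "\<lambda>_. borel"]
      measurable_component_fst [OF \<open>c \<in> I\<close>]
      measurable_compose [OF measurable_component_singleton [OF \<open>c \<in> I\<close>] borel_measurable_fst_snd_real(2)]
    have "{p \<in> space ?P. snd (p c) < slope (p a) (p b) * fst (p c) + intercept (p a) (p b)} \<in> sets ?P"
      by (intro borel_measurable_less) measurable
    then show ?thesis
      using True by (simp add: below_line_def)
  next
    case False
    then have "{p \<in> space ?P. c \<in> {c \<in> I - {a, b}.
        p c \<in> below_line (slope (p a) (p b)) (intercept (p a) (p b))}} = {}"
      by blast
    then show ?thesis by (simp only: sets.empty_sets)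
  qed
  have [measurable]: "(\<lambda>p. below_count I p a b) \<in> ?P \<rightarrow>\<^sub>M count_space UNIV"
    unfolding below_count_def by (rule measurable_card) (rule c)
  have "Measurable.pred ?P (\<lambda>p. fst (p a) < fst (p b))"
    unfolding pred_def using ab by (intro borel_measurable_less measurable_component_fst)
  moreover have "Measurable.pred ?P (\<lambda>p. below_count I p a b = n)"
    by measurable
  ultimately show ?thesis
    unfolding pairs_above_def using ab by simp
qed

text \<open>The line passes through \<open>z\<close>, a point of the open disc, so its distance from
  the origin is below 1. For equal abscissae, division by zero makes it the horizontal line through
  \<open>z\<close>, and the argument still applies.\<close>

lemma abs_intercept_less:
  assumes "archimedes_density z \<noteq> 0"
  shows "\<bar>intercept z z'\<bar> < sqrt (1 + (slope z z')\<^sup>2)"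
proof -
  have "z = (fst z, slope z z' * fst z + intercept z z')"
    by (simp add: intercept_def prod_eq_iff)
  then show ?thesis
    using assms archimedes_density_off_disc by (metis not_le)
qed

lemma emeasure_archimedes_measure_below_line:
  assumes "archimedes_density z \<noteq> 0"
  shows "emeasure archimedes_measure (below_line (slope z z') (intercept z z'))
    = ennreal ((1 + intercept z z' / sqrt (1 + (slope z z')\<^sup>2)) / 2)"
proof -
  show ?thesis
    unfolding archimedes_measure_def using abs_intercept_less [OF assms(1)]
    by (simp add: emeasure_density nn_integral_archimedes_density_below_line)
qed

text \<open>Given the two points, the other \<open>n + k\<close> lie below their line independently
  with the same probability \<open>(1 + r) / 2\<close>, so the count is binomial; averaging over
  \<open>r\<close> gives the Beta value.\<close>

lemma nn_integral_pair_above: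
  assumes prob: "prob_space archimedes_measure"
    and I: "finite I" "a \<in> I" "b \<in> I" "a \<noteq> b" "card I = n + k + 2"
  shows "(\<integral>\<^sup>+p. indicator (pairs_above I n p) (a, b) \<partial>Pi\<^sub>M I (\<lambda>_. archimedes_measure))
    = ennreal (real ((n + k) choose n) * (4 / pi * Beta (real n + 3 / 2) (real k + 3 / 2)))"
proof -
  interpret prob_space archimedes_measure by fact
  interpret product_sigma_finite "\<lambda>_. archimedes_measure" by standard
  define J where "J = I - {a, b}"
  have J: "finite J" "b \<notin> J" "a \<notin> insert b J" "I = insert a (insert b J)" "card J = n + k"
    using I by (auto simp: J_def card_Diff_subset)
  let ?D = archimedes_measure
  let ?L = "\<lambda>z z'. below_line (slope z z') (intercept z z')"
  let ?r = "\<lambda>z z'. intercept z z' / sqrt (1 + (slope z z')\<^sup>2)"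
  \<comment> \<open>The conditional probability of exactly \<open>n\<close> points below, as a
    function of the signed distance of the line.\<close>
  define \<phi> where "\<phi> r = ennreal (real ((n + k) choose n)) *
    ennreal (((1 + r) / 2) ^ n * (1 - (1 + r) / 2) ^ k)" for r
  have [measurable]: "\<phi> \<in> borel_measurable borel"
    unfolding \<phi>_def by measurable
  define f where "f p = (if (a, b) \<in> pairs_above I n p then 1 else 0 :: ennreal)" for p
  have sets_P: "measurable (Pi\<^sub>M K (\<lambda>_. ?D)) N = measurable (Pi\<^sub>M K (\<lambda>_. borel)) N"
    for N :: "'x measure" and K :: "nat set"
    by (intro measurable_cong_sets sets_PiM_cong) simp_all
  have f_meas: "f \<in> borel_measurable (Pi\<^sub>M (insert a (insert b J)) (\<lambda>_. ?D))"
    unfolding f_def sets_P J(4) [symmetric]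
    by (intro measurable_If measurable_const pred_pairs_above [unfolded pred_def] I)
      simp_all
  have f_upd_meas: "(\<lambda>x. f (x(a := z))) \<in> borel_measurable (Pi\<^sub>M (insert b J) (\<lambda>_. ?D))" for z
    by (intro measurable_compose [OF _ f_meas] measurable_fun_upd) auto
  have f_upd: "f ((x(b := z'))(a := z)) =
      (if fst z < fst z' then indicator {x \<in> space (Pi\<^sub>M J (\<lambda>_. ?D)). card {c\<in>J. x c \<in> ?L z z'} = n} x else 0)"
    if "x \<in> space (Pi\<^sub>M J (\<lambda>_. ?D))" for x z z'
  proof -
    have "{c \<in> I - {a, b}. ((x(b := z'))(a := z)) c \<in> ?L z z'} = {c\<in>J. x c \<in> ?L z z'}"
      by (auto simp: J_def)
    moreover have "((x(b := z'))(a := z)) a = z" "((x(b := z'))(a := z)) b = z'"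
      using I by auto
    ultimately have "(a, b) \<in> pairs_above I n ((x(b := z'))(a := z)) \<longleftrightarrow>
        fst z < fst z' \<and> card {c\<in>J. x c \<in> ?L z z'} = n"
      using I(2,3) by (simp only: pairs_above_def below_count_def mem_Collect_eq prod.case simp_thms)
    then show ?thesis
      using that by (simp only: f_def indicator_def mem_Collect_eq simp_thms split: if_splits) simp
  qed
  have inner: "(\<integral>\<^sup>+x. f ((x(b := z'))(a := z)) \<partial>Pi\<^sub>M J (\<lambda>_. ?D)) =
      indicator {fst z<..} (fst z') * \<phi> (?r z z')"
    if z: "archimedes_density z \<noteq> 0" for z z'
  proof (cases "fst z < fst z'")
    case True
    let ?E = "{x \<in> space (Pi\<^sub>M J (\<lambda>_. ?D)). card {c\<in>J. x c \<in> ?L z z'} = n}"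
    have below: "emeasure ?D (?L z z') = ennreal ((1 + ?r z z') / 2)"
      using emeasure_archimedes_measure_below_line [OF z] by simp
    have "\<bar>?r z z'\<bar> < 1"
      using abs_intercept_less [OF z] by (simp add: abs_divide divide_less_eq add_pos_nonneg)
    moreover have "0 \<le> (1 + r) / 2" if "\<bar>r\<bar> < 1" for r :: real
      using that by simp
    ultimately have r: "0 \<le> (1 + ?r z z') / 2" by blast
    then have P: "prob (?L z z') = (1 + ?r z z') / 2"
      using below by (simp add: measure_def)
    have E: "?E \<in> sets (Pi\<^sub>M J (\<lambda>_. ?D))"
      using J(1) by (rule emeasure_PiM_card_eq_binomial(1)) simp
    have "(\<integral>\<^sup>+x. f ((x(b := z'))(a := z)) \<partial>Pi\<^sub>M J (\<lambda>_. ?D)) =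
        (\<integral>\<^sup>+x. indicator ?E x \<partial>Pi\<^sub>M J (\<lambda>_. ?D))"
      using True by (intro nn_integral_cong) (simp only: f_upd if_True)
    also have "\<dots> = emeasure (Pi\<^sub>M J (\<lambda>_. ?D)) ?E"
      using E by simp
    also have "\<dots> = ennreal (real (card J choose n) * prob (?L z z') ^ n * (1 - prob (?L z z')) ^ (card J - n))"
      using J(1) by (rule emeasure_PiM_card_eq_binomial(2)) simp
    also have "\<dots> = \<phi> (?r z z')"
      unfolding \<phi>_def P by (simp add: J mult.assoc ennreal_mult')
    finally show ?thesis using True by simp
  next
    case False
    then have "(\<integral>\<^sup>+x. f ((x(b := z'))(a := z)) \<partial>Pi\<^sub>M J (\<lambda>_. ?D)) = (\<integral>\<^sup>+x. 0 \<partial>Pi\<^sub>M J (\<lambda>_. ?D))"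
      by (intro nn_integral_cong) (simp only: f_upd if_False)
    then show ?thesis using False by simp
  qed
  have "(\<integral>\<^sup>+p. indicator (pairs_above I n p) (a, b) \<partial>Pi\<^sub>M I (\<lambda>_. ?D)) =
      (\<integral>\<^sup>+p. f p \<partial>Pi\<^sub>M (insert a (insert b J)) (\<lambda>_. ?D))"
    unfolding J(4) [symmetric] f_def by (intro nn_integral_cong) (simp add: indicator_def)
  also have "\<dots> = (\<integral>\<^sup>+z. \<integral>\<^sup>+x. f (x(a := z)) \<partial>Pi\<^sub>M (insert b J) (\<lambda>_. ?D) \<partial>?D)"
    using J f_meas by (intro product_nn_integral_insert_rev) auto
  also have "\<dots> = (\<integral>\<^sup>+z. \<integral>\<^sup>+z'. \<integral>\<^sup>+x. f ((x(b := z'))(a := z)) \<partial>Pi\<^sub>M J (\<lambda>_. ?D) \<partial>?D \<partial>?D)"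
    using J f_upd_meas by (intro nn_integral_cong product_nn_integral_insert_rev) auto
  also have "\<dots> = (\<integral>\<^sup>+z. \<integral>\<^sup>+z'. indicator {fst z<..} (fst z') * \<phi> (?r z z') \<partial>?D \<partial>?D)"
  proof (rule nn_integral_cong_AE)
    \<comment> \<open>\<open>inner\<close> covers only a first point inside the disc; the other
      positions are null for the Archimedes measure.\<close>
    have "AE z in ?D. archimedes_density z \<noteq> 0"
      unfolding archimedes_measure_def by (subst AE_density) auto
    then show "AE z in ?D. (\<integral>\<^sup>+z'. \<integral>\<^sup>+x. f ((x(b := z'))(a := z)) \<partial>Pi\<^sub>M J (\<lambda>_. ?D) \<partial>?D) =
        (\<integral>\<^sup>+z'. indicator {fst z<..} (fst z') * \<phi> (?r z z') \<partial>?D)"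
      by eventually_elim (simp add: inner)
  qed
  also have "\<dots> = (\<integral>\<^sup>+z. \<integral>\<^sup>+z'. ennreal (archimedes_density z) * (ennreal (archimedes_density z') *
      (indicator {fst z<..} (fst z') * \<phi> (?r z z'))) \<partial>lborel \<partial>lborel)"
    unfolding archimedes_measure_def
    by (simp add: nn_integral_density nn_integral_cmult indicator_def)
  also have "\<dots> = ennreal (1 / pi) * (\<integral>\<^sup>+r. \<phi> r * ennreal (indicator {-1<..<1} r * sqrt (1 - r\<^sup>2)) \<partial>lborel)"
    by (rule nn_integral_archimedes_line_distance) measurable
  also have "(\<integral>\<^sup>+r. \<phi> r * ennreal (indicator {-1<..<1} r * sqrt (1 - r\<^sup>2)) \<partial>lborel)
      = ennreal (real ((n + k) choose n)) * ennreal (4 * Beta (real n + 3 / 2) (real k + 3 / 2))"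
    unfolding \<phi>_def mult.assoc
    by (subst nn_integral_cmult, measurable) (simp only: nn_integral_semicircle_Beta)
  also have "ennreal (1 / pi) * \<dots> =
      ennreal (real ((n + k) choose n) * (4 / pi * Beta (real n + 3 / 2) (real k + 3 / 2)))"
    by (simp add: ac_simps flip: ennreal_mult')
  finally show ?thesis .
qed

text \<open>Linearity over the ordered pairs of distinct indices. Their number times the binomial
  coefficient is \<open>fact (n + k + 2) / (fact n * fact k)\<close>, whose numerator is absorbed by
  \<open>Beta_half_integers\<close>.\<close>

lemma nn_integral_card_pairs_above:
  assumes prob: "prob_space archimedes_measure" and I: "finite I" "card I = n + k + 2"
  shows "(\<integral>\<^sup>+p. of_nat (card (pairs_above I n p)) \<partial>Pi\<^sub>M I (\<lambda>_. archimedes_measure))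
    = ennreal (falling_factorial (real n + 1 / 2) n * falling_factorial (real k + 1 / 2) k
        / (fact n * fact k))"
proof -
  let ?P = "Pi\<^sub>M I (\<lambda>_. archimedes_measure)"
  let ?O = "(I \<times> I) - Id"
  let ?B = "4 / pi * Beta (real n + 3 / 2) (real k + 3 / 2)"
  have finO: "finite ?O" using I by auto
  have "(\<integral>\<^sup>+p. of_nat (card (pairs_above I n p)) \<partial>?P) =
      (\<integral>\<^sup>+p. (\<Sum>e\<in>?O. indicator (pairs_above I n p) e) \<partial>?P)"
  proof (rule nn_integral_cong)
    fix p
    have "pairs_above I n p \<subseteq> ?O"
      by (auto simp: pairs_above_def)
    then have "(\<Sum>e\<in>pairs_above I n p. 1) = (\<Sum>e\<in>?O. indicator (pairs_above I n p) e :: ennreal)"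
      using finO by (intro sum.mono_neutral_cong_left) auto
    then show "of_nat (card (pairs_above I n p)) = (\<Sum>e\<in>?O. indicator (pairs_above I n p) e :: ennreal)"
      by simp
  qed
  also have "\<dots> = (\<Sum>e\<in>?O. \<integral>\<^sup>+p. indicator (pairs_above I n p) e \<partial>?P)"
  proof (rule nn_integral_sum)
    fix e assume "e \<in> ?O"
    then obtain a b where e: "e = (a, b)" "a \<in> I" "b \<in> I" by auto
    have "measurable ?P N = measurable (Pi\<^sub>M I (\<lambda>_. borel)) N" for N :: "bool measure"
      by (intro measurable_cong_sets sets_PiM_cong) simp_all
    then have [measurable]: "Measurable.pred ?P (\<lambda>p. e \<in> pairs_above I n p)"
      using pred_pairs_above [OF e(2,3)] e(1) by simp
    show "(\<lambda>p. indicator (pairs_above I n p) e) \<in> borel_measurable ?P"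
      unfolding indicator_def by measurable
  qed
  also have "\<dots> = (\<Sum>e\<in>?O. ennreal (real ((n + k) choose n) * ?B))"
  proof (rule sum.cong)
    fix e assume "e \<in> ?O"
    then obtain a b where "e = (a, b)" "a \<in> I" "b \<in> I" "a \<noteq> b" by auto
    then show "(\<integral>\<^sup>+p. indicator (pairs_above I n p) e \<partial>?P) = ennreal (real ((n + k) choose n) * ?B)"
      using nn_integral_pair_above [OF prob I(1) _ _ _ I(2)] by simp
  qed simp
  also have "\<dots> = ennreal (real (card ?O) * (real ((n + k) choose n) * ?B))"
    by (simp only: sum_constant ennreal_of_nat_eq_real_of_nat ennreal_mult' of_nat_0_le_iff)
  also have "card ?O = (n + k + 2) * (n + k + 1)"
  proof -
    have "?O = (SIGMA a:I. I - {a})" by auto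
    then show ?thesis using I by (simp add: card_SigmaI card_Diff_subset)
  qed
  also have "real ((n + k + 2) * (n + k + 1)) * (real ((n + k) choose n) * ?B)
      = ?B * fact (n + k + 2) / (fact n * fact k)"
  proof -
    have 1: "real ((n + k) choose n) = fact (n + k) / (fact n * fact k)"
      by (simp add: binomial_fact)
    have 2: "(fact (n + k + 2) :: real) = real ((n + k + 2) * (n + k + 1)) * fact (n + k)"
      by (simp add: algebra_simps)
    have "N * (F / (u * v) * B) = B * (N * F) / (u * v)" for N F u v B :: real
      by simp
    then show ?thesis unfolding 1 2 .
  qed
  also have "\<dots> = falling_factorial (real n + 1 / 2) n * falling_factorial (real k + 1 / 2) k
        / (fact n * fact k)"
    by (simp only: Beta_half_integers)
  finally show ?thesis .
qed

subsection \<open>Orders of projections\<close>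

text \<open>Ranks start at 1, and labels outside \<open>{1..m}\<close> are fixed, so that distinct
  values give a permutation in the sense of \<open>permutes\<close>.\<close>

definition value_rank :: "nat \<Rightarrow> (nat \<Rightarrow> real) \<Rightarrow> nat \<Rightarrow> nat" where
  "value_rank m f a = (if a \<in> {1..m} then card {c \<in> {1..m}. f c \<le> f a} else a)"

lemma value_rank_less:
  assumes "a \<in> {1..m}" "b \<in> {1..m}" "f a < f b"
  shows "value_rank m f a < value_rank m f b"
proof -
  have "{c \<in> {1..m}. f c \<le> f a} \<subset> {c \<in> {1..m}. f c \<le> f b}"
  proof (rule psubsetI)
    have "b \<in> {c \<in> {1..m}. f c \<le> f b}" "b \<notin> {c \<in> {1..m}. f c \<le> f a}"
      using assms by auto
    then show "{c \<in> {1..m}. f c \<le> f a} \<noteq> {c \<in> {1..m}. f c \<le> f b}" by blast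
  qed (use assms in auto)
  then show ?thesis
    using assms by (simp add: value_rank_def psubset_card_mono)
qed

lemma value_rank_permutes:
  assumes "inj_on f {1..m}"
  shows "value_rank m f permutes {1..m}"
proof (rule bij_imp_permutes)
  have "inj_on (value_rank m f) {1..m}"
  proof (rule inj_onI, rule ccontr)
    fix a b assume ab: "a \<in> {1..m}" "b \<in> {1..m}" "value_rank m f a = value_rank m f b" "a \<noteq> b"
    then have "f a \<noteq> f b" using assms by (auto dest: inj_onD)
    then show False
      using value_rank_less[of a m b f] value_rank_less[of b m a f] ab by linarith
  qed
  moreover have "value_rank m f ` {1..m} \<subseteq> {1..m}"
  proof (rule image_subsetI)
    fix a assume a: "a \<in> {1..m}"
    have "card {c \<in> {1..m}. f c \<le> f a} \<le> card {1..m}" by (intro card_mono) auto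
    moreover have "0 < card {c \<in> {1..m}. f c \<le> f a}" using a by (auto simp: card_gt_0_iff)
    ultimately show "value_rank m f a \<in> {1..m}" using a by (simp add: value_rank_def Suc_le_eq)
  qed
  ultimately show "bij_betw (value_rank m f) {1..m} {1..m}"
    by (simp add: bij_betw_def endo_inj_surj)
qed (auto simp: value_rank_def)

text \<open>A sorting permutation sends each rank to the label holding it, so it inverts the ranking
  and is unique. This settles both the definite description in \<open>x_ordered\<close> and the
  permutation in \<open>proj_order\<close>.\<close>

lemma strict_mono_on_permuted_iff:
  assumes inj: "inj_on f {1..m}" and \<pi>: "\<pi> permutes {1..m}"
  shows "strict_mono_on {1..m} (\<lambda>i. f (\<pi> i)) \<longleftrightarrow> \<pi> = inv (value_rank m f)"
proof
  assume mono: "strict_mono_on {1..m} (\<lambda>i. f (\<pi> i))"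
  have "value_rank m f (\<pi> i) = i" for i
  proof (cases "i \<in> {1..m}")
    case True
    have "{c \<in> {1..m}. f c \<le> f (\<pi> i)} = \<pi> ` {1..i}"
    proof (intro equalityI subsetI)
      fix c assume c: "c \<in> {c \<in> {1..m}. f c \<le> f (\<pi> i)}"
      then obtain l where l: "l \<in> {1..m}" "c = \<pi> l"
        using permutes_image[OF \<pi>] by blast
      have "\<not> i < l"
      proof
        assume "i < l"
        then have "f (\<pi> i) < f (\<pi> l)" using strict_mono_onD[OF mono True l(1)] by blast
        then show False using c l by simp
      qed
      then show "c \<in> \<pi> ` {1..i}" using l by auto
    next
      fix c assume "c \<in> \<pi> ` {1..i}"
      then obtain l where l: "l \<in> {1..i}" "c = \<pi> l" by blast
      then have "l \<in> {1..m}" using True by auto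
      moreover have "f (\<pi> l) \<le> f (\<pi> i)"
        using strict_mono_onD[OF mono \<open>l \<in> {1..m}\<close> True] l by (cases "l = i") auto
      ultimately show "c \<in> {c \<in> {1..m}. f c \<le> f (\<pi> i)}"
        using l permutes_in_image[OF \<pi>] by auto
    qed
    moreover have "card (\<pi> ` {1..i}) = i"
      using \<pi> by (simp add: card_image permutes_inj_on)
    ultimately show ?thesis
      using True permutes_in_image[OF \<pi>] by (simp add: value_rank_def)
  next
    case False
    then show ?thesis using permutes_not_in[OF \<pi> False] by (auto simp: value_rank_def)
  qed
  then have "value_rank m f \<circ> \<pi> = id" by auto
  then show "\<pi> = inv (value_rank m f)"
    using permutes_bij[OF value_rank_permutes[OF inj]] permutes_bij[OF \<pi>]
    by (metis bij_is_inj comp_assoc id_comp comp_id inv_o_cancel)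
next
  assume eq: "\<pi> = inv (value_rank m f)"
  have r: "value_rank m f (\<pi> i) = i" for i
    unfolding eq using permutes_inverses(1)[OF value_rank_permutes[OF inj]] .
  show "strict_mono_on {1..m} (\<lambda>i. f (\<pi> i))"
  proof (rule strict_mono_onI, rule ccontr)
    fix i j assume ij: "i \<in> {1..m}" "j \<in> {1..m}" "i < j" "\<not> f (\<pi> i) < f (\<pi> j)"
    have in_m: "\<pi> i \<in> {1..m}" "\<pi> j \<in> {1..m}" using ij permutes_in_image[OF \<pi>] by auto
    have "f (\<pi> j) < f (\<pi> i) \<or> \<pi> j = \<pi> i"
      using ij(4) in_m inj by (auto dest: inj_onD simp: not_less le_less)
    then have "j \<le> i"
      using value_rank_less[OF in_m(2,1), of f] r by (metis less_imp_le order_refl)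
    then show False using ij by simp
  qed
qed

abbreviation projection :: "(nat \<Rightarrow> real \<times> real) \<Rightarrow> real \<Rightarrow> nat \<Rightarrow> real" where
  "projection x \<theta> a \<equiv> x a \<bullet> (cos \<theta>, sin \<theta>)"

lemma proj_order_iff:
  assumes "inj_on (projection x \<theta>) {1..m}"
  shows "proj_order m x \<theta> \<sigma> \<longleftrightarrow> \<sigma> = inv (value_rank m (projection x \<theta>))"
  unfolding proj_order_def
  using strict_mono_on_permuted_iff[OF assms] permutes_inv[OF value_rank_permutes[OF assms]] by blast

lemma inj_on_projection_if_proj_order:
  assumes "proj_order m x \<theta> \<sigma>"
  shows "inj_on (projection x \<theta>) {1..m}"
proof -
  have \<sigma>: "\<sigma> permutes {1..m}" and "strict_mono_on {1..m} (\<lambda>i. projection x \<theta> (\<sigma> i))"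
    using assms by (auto simp: proj_order_def)
  then have "inj_on (projection x \<theta> \<circ> \<sigma>) {1..m}"
    by (simp add: comp_def strict_mono_on_imp_inj_on)
  then show ?thesis
    using inj_on_image_iff permutes_image[OF \<sigma>] by (metis inj_on_imageI)
qed

text \<open>The two sets are nested. Hence the number of swaps performed will determine which pairs
  have been swapped.\<close>

lemma initial_segments_eq_if_card_eq:
  fixes f :: "'a \<Rightarrow> real"
  assumes "finite P" "card {e\<in>P. f e < s} = card {e\<in>P. f e < t}"
  shows "{e\<in>P. f e < s} = {e\<in>P. f e < t}"
proof (cases "s \<le> t")
  case True
  then show ?thesis using assms by (intro card_subset_eq) auto
next
  case False
  then show ?thesis using assms by (intro card_subset_eq [symmetric]) auto
qed

text \<open>Induction crosses one point of \<open>C\<close> at a time. \<open>C\<close> will be the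
  set of swap angles, and the points found are regular angles between successive swaps.\<close>

lemma exists_between_with_initial_card:
  fixes C :: "real set"
  assumes C: "finite C" "C \<subseteq> {0<..<T}" and T: "0 < T"
  shows "t \<le> card C \<Longrightarrow> \<exists>\<theta>\<in>{0..T} - C. card {c\<in>C. c < \<theta>} = t"
proof (induction t)
  case 0
  have "{c\<in>C. c < 0} = {}" using C by force
  then have "card {c\<in>C. c < 0} = 0" by (simp only: card.empty)
  moreover have "0 \<in> {0..T} - C" using C T by auto
  ultimately show ?case by blast
next
  case (Suc t)
  then obtain \<theta> where \<theta>: "\<theta> \<in> {0..T} - C" "card {c\<in>C. c < \<theta>} = t" by auto
  have "{c\<in>C. \<theta> < c} \<noteq> {}"
  proof
    assume "{c\<in>C. \<theta> < c} = {}"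
    then have "x < \<theta>" if "x \<in> C" for x
      using that \<theta>(1) by (metis (mono_tags, lifting) DiffD2 empty_iff linorder_neqE_linordered_idom mem_Collect_eq)
    then have "C = {c\<in>C. c < \<theta>}" by blast
    then show False using Suc.prems \<theta>(2) by simp
  qed
  define c where "c = Min {c\<in>C. \<theta> < c}"
  have c: "c \<in> C" "\<theta> < c" "\<And>c'. c' \<in> C \<Longrightarrow> \<theta> < c' \<Longrightarrow> c \<le> c'"
    using Min_in[of "{c\<in>C. \<theta> < c}"] C \<open>{c\<in>C. \<theta> < c} \<noteq> {}\<close> by (auto simp: c_def)
  \<comment> \<open>The first point of \<open>C\<close> after \<open>c\<close>, or \<open>T\<close>
    if there is none; the midpoint of \<open>c\<close> and \<open>d\<close> has crossed
    \<open>c\<close> and nothing else.\<close>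
  define d where "d = Min (insert T {c'\<in>C. c < c'})"
  have d: "c < d" "d \<le> T" "\<And>c'. c' \<in> C \<Longrightarrow> c < c' \<Longrightarrow> d \<le> c'"
    using C c(1) by (auto simp: d_def)
  let ?\<theta> = "(c + d) / 2"
  have "c < ?\<theta>" "?\<theta> < d" using d by auto
  have iff: "c' < ?\<theta> \<longleftrightarrow> c' < \<theta> \<or> c' = c" if "c' \<in> C" for c'
  proof -
    have "c' \<noteq> \<theta>" using that \<theta>(1) by auto
    then have "c' < \<theta> \<or> c' = c \<or> \<theta> < c' \<and> c < c'"
      using c(3)[OF that] by (auto simp: neq_iff le_less)
    then show ?thesis
      by (elim disjE conjE) (use that c(2) d(3)[of c'] \<open>c < ?\<theta>\<close> \<open>?\<theta> < d\<close> in auto)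
  qed
  have "{c'\<in>C. c' < ?\<theta>} = insert c {c'\<in>C. c' < \<theta>}"
    using iff c(1) by blast
  then have "card {c'\<in>C. c' < ?\<theta>} = Suc t"
    using \<theta>(2) c(2) C by simp
  moreover have "?\<theta> \<notin> C"
    using iff[of ?\<theta>] d(3)[of ?\<theta>] \<open>c < ?\<theta>\<close> \<open>?\<theta> < d\<close> by auto
  moreover have "?\<theta> \<in> {0..T}"
    using c(1) C d \<open>c < ?\<theta>\<close> \<open>?\<theta> < d\<close> by force
  ultimately show ?case by blast
qed

section \<open>Swap angles\<close>

text \<open>The hypotheses make \<psi> the direction of the upward normal, and the projection of
  \<open>(u, v)\<close> is \<open>sin \<psi> * (v - k * u)\<close> with \<open>k\<close> the slope:
  an increasing function of the height relative to the line.\<close>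

lemma below_line_iff_projection:
  assumes s: "0 < sin \<psi>" and \<psi>: "cos \<psi> = - slope (x a) (x b) * sin \<psi>"
  shows "x c \<in> below_line (slope (x a) (x b)) (intercept (x a) (x b)) \<longleftrightarrow>
    projection x \<psi> c < projection x \<psi> a"
proof -
  have "projection x \<psi> c < projection x \<psi> a \<longleftrightarrow>
      sin \<psi> * (snd (x c) - slope (x a) (x b) * fst (x c)) < sin \<psi> * (snd (x a) - slope (x a) (x b) * fst (x a))"
    by (simp add: inner_prod_def \<psi> algebra_simps)
  also have "\<dots> \<longleftrightarrow> snd (x c) - slope (x a) (x b) * fst (x c) < snd (x a) - slope (x a) (x b) * fst (x a)"
    using s by (rule mult_less_cancel_left_pos)
  finally show ?thesis
    by (auto simp: below_line_def intercept_def)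
qed

text \<open>The direction of the upward normal to the line through the two points: a quarter turn
  beyond its angle of inclination.\<close>

definition swap_angle :: "(nat \<Rightarrow> real \<times> real) \<Rightarrow> nat \<times> nat \<Rightarrow> real" where
  "swap_angle x = (\<lambda>(a, b). pi / 2 + arctan (slope (x a) (x b)))"

lemma swap_angle_bounds: "0 < swap_angle x e" "swap_angle x e < pi"
  using arctan_lbound [of "slope (x (fst e)) (x (snd e))"] arctan_ubound [of "slope (x (fst e)) (x (snd e))"]
  by (simp_all add: swap_angle_def split_beta)

lemma sin_swap_angle_pos: "0 < sin (swap_angle x e)"
  by (intro sin_gt_zero swap_angle_bounds)

lemma cos_swap_angle:
  "cos (swap_angle x (a, b)) = - slope (x a) (x b) * sin (swap_angle x (a, b))"
proof -
  let ?t = "arctan (slope (x a) (x b))"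
  have "slope (x a) (x b) * cos ?t = sin ?t"
    using tan_arctan[of "slope (x a) (x b)"] cos_arctan_not_zero by (metis nonzero_divide_eq_eq tan_def)
  then show ?thesis
    by (simp add: swap_angle_def cos_add sin_add)
qed

text \<open>With \<psi> the swap angle, the difference of the projections is a positive multiple of
  \<open>sin (\<psi> - \<theta>)\<close>. On \<open>{0..pi}\<close> this changes sign exactly once,
  at \<psi>.\<close>

lemma projection_less_iff:
  assumes ab: "fst (x a) < fst (x b)" and \<theta>: "0 \<le> \<theta>" "\<theta> \<le> pi"
  shows "projection x \<theta> a < projection x \<theta> b \<longleftrightarrow> \<theta> < swap_angle x (a, b)"
    and "projection x \<theta> b < projection x \<theta> a \<longleftrightarrow> swap_angle x (a, b) < \<theta>"
proof -
  let ?k = "slope (x a) (x b)" and ?\<psi> = "swap_angle x (a, b)"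
  let ?d = "fst (x b) - fst (x a)"
  have d: "0 < ?d" using ab by simp
  have k: "snd (x b) - snd (x a) = ?k * ?d"
    using ab by (simp add: slope_def)
  have "sin ?\<psi> * (projection x \<theta> b - projection x \<theta> a) = 
      ?d * (sin ?\<psi> * cos \<theta>) + (snd (x b) - snd (x a)) * (sin ?\<psi> * sin \<theta>)"
    by (simp add: inner_prod_def algebra_simps)
  also have "\<dots> = ?d * (sin ?\<psi> * cos \<theta> - cos ?\<psi> * sin \<theta>)"
    unfolding k by (simp add: cos_swap_angle algebra_simps)
  also have "\<dots> = ?d * sin (?\<psi> - \<theta>)"
    by (simp add: sin_diff)
  finally have eq: "sin ?\<psi> * (projection x \<theta> b - projection x \<theta> a) = ?d * sin (?\<psi> - \<theta>)" .
  have \<psi>: "0 < sin ?\<psi>" by (rule sin_swap_angle_pos)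
  have pos: "projection x \<theta> a < projection x \<theta> b" if "\<theta> < ?\<psi>"
  proof -
    have "0 < sin (?\<psi> - \<theta>)"
      using that \<theta> swap_angle_bounds[of x "(a, b)"] by (intro sin_gt_zero) auto
    then have "0 < sin ?\<psi> * (projection x \<theta> b - projection x \<theta> a)"
      unfolding eq using d by simp
    then show ?thesis using \<psi> by (simp add: zero_less_mult_iff)
  qed
  have neg: "projection x \<theta> b < projection x \<theta> a" if "?\<psi> < \<theta>"
  proof -
    have "0 < sin (\<theta> - ?\<psi>)"
      using that \<theta> swap_angle_bounds[of x "(a, b)"] by (intro sin_gt_zero) auto
    then have "sin (?\<psi> - \<theta>) < 0"
      by (metis minus_diff_eq neg_less_0_iff_less sin_minus)
    then have "sin ?\<psi> * (projection x \<theta> b - projection x \<theta> a) < 0"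
      unfolding eq using d by (simp add: mult_pos_neg)
    then show ?thesis using \<psi> by (simp add: mult_less_0_iff)
  qed
  have zero: "projection x \<theta> a = projection x \<theta> b" if "\<theta> = ?\<psi>"
    using eq \<psi> that by simp
  show "projection x \<theta> a < projection x \<theta> b \<longleftrightarrow> \<theta> < ?\<psi>"
    using pos neg zero by (metis linorder_neqE_linordered_idom order_less_asym order_less_irrefl)
  show "projection x \<theta> b < projection x \<theta> a \<longleftrightarrow> ?\<psi> < \<theta>"
    using pos neg zero by (metis linorder_neqE_linordered_idom order_less_asym order_less_irrefl)
qed

subsection \<open>The geometric sorting network\<close>

lemma configuration_0 [simp]: "configuration s 0 = id"
  by (simp add: configuration_def)

lemma configuration_Suc:
  assumes "t < length s"
  shows "configuration s (Suc t) = configuration s t \<circ> adj_transp (s ! t)"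
proof -
  have "foldr (\<circ>) (map adj_transp us @ [f]) id = foldr (\<circ>) (map adj_transp us) id \<circ> f" for us f
  proof (induction us)
    case (Cons u us)
    then show ?case by (simp only: append_Cons list.map foldr.simps comp_apply comp_assoc)
  qed simp
  then show ?thesis
    unfolding configuration_def take_Suc_conv_app_nth [OF assms] map_append list.map .
qed

lemma bij_configuration: "bij (configuration s t)"
proof -
  have "bij (foldr (\<circ>) (map adj_transp us) id)" for us
  proof (induction us)
    case (Cons u us)
    have bij: "bij (adj_transp u)" by (simp add: adj_transp_def)
    have step: "foldr (\<circ>) (map adj_transp (u # us)) id = adj_transp u \<circ> foldr (\<circ>) (map adj_transp us) id"
      by simp
    show ?case unfolding step by (rule bij_comp [OF Cons bij])
  qed (simp add: id_def [symmetric])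
  then show ?thesis by (simp add: configuration_def)
qed

lemma adj_transp_eq_iff: "adj_transp i = adj_transp j \<longleftrightarrow> i = j"
proof
  assume eq: "adj_transp i = adj_transp j"
  show "i = j"
    using fun_cong[OF eq, of i] fun_cong[OF eq, of j]
    by (auto simp: adj_transp_def Transposition.transpose_def split: if_splits)
qed simp

lemma adj_transp_neq_id: "adj_transp i \<noteq> id"
proof
  assume "adj_transp i = id"
  then have "adj_transp i i = i" by simp
  then show False by (simp add: adj_transp_def)
qed

text \<open>Each step climbs by at least one: counting up from 0 gives \<open>t \<le> h t\<close>,
  counting down from \<open>M\<close> gives \<open>h t \<le> t\<close>.\<close>

lemma strict_mono_nat_eq_id:
  fixes h :: "nat \<Rightarrow> nat"
  assumes mono: "\<And>t t'. t < t' \<Longrightarrow> t' \<le> M \<Longrightarrow> h t < h t'" and M: "h M \<le> M" and "t \<le> M"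
  shows "h t = t"
proof -
  have "t \<le> M \<Longrightarrow> t \<le> h t" for t
  proof (induction t)
    case (Suc t)
    then show ?case using mono[of t "Suc t"] by simp
  qed simp
  moreover have "d \<le> M \<Longrightarrow> h (M - d) + d \<le> h M" for d
  proof (induction d)
    case (Suc d)
    moreover have "M - Suc d < M - d" using Suc.prems by simp
    ultimately show ?case using mono[of "M - Suc d" "M - d"] by simp
  qed simp
  from this[of "M - t"] have "h t \<le> t"
    using M \<open>t \<le> M\<close> by simp
  ultimately show ?thesis using \<open>t \<le> M\<close> by (simp add: le_antisym)
qed

section \<open>Points sorted by abscissa, with distinct slopes\<close>

text \<open>What general position provides after sorting: both a collinear triple and a pair of
  parallel lines would show as equal slopes of two different pairs.\<close>

locale sorted_points =
  fixes m :: nat and x :: "nat \<Rightarrow> real \<times> real"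
  assumes fst_less: "a \<in> {1..m} \<Longrightarrow> b \<in> {1..m} \<Longrightarrow> a < b \<Longrightarrow> fst (x a) < fst (x b)"
    and slopes_distinct:
      "a \<in> {1..m} \<Longrightarrow> b \<in> {1..m} \<Longrightarrow> c \<in> {1..m} \<Longrightarrow> d \<in> {1..m} \<Longrightarrow> a < b \<Longrightarrow> c < d \<Longrightarrow>
        slope (x a) (x b) = slope (x c) (x d) \<Longrightarrow> a = c \<and> b = d"
begin

definition pairs :: "(nat \<times> nat) set" where
  "pairs = {(a, b). a \<in> {1..m} \<and> b \<in> {1..m} \<and> a < b}"

lemma finite_pairs [simp]: "finite pairs"
  by (rule finite_subset[of _ "{1..m} \<times> {1..m}"]) (auto simp: pairs_def)

lemma card_pairs: "card pairs = m choose 2"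
proof -
  have "bij_betw (\<lambda>(a, b). {a, b}) pairs {S. S \<subseteq> {1..m} \<and> card S = 2}"
    unfolding bij_betw_def
  proof
    show "inj_on (\<lambda>(a, b). {a, b}) pairs"
      by (auto simp: inj_on_def pairs_def doubleton_eq_iff)
    show "(\<lambda>(a, b). {a, b}) ` pairs = {S. S \<subseteq> {1..m} \<and> card S = 2}"
    proof (intro equalityI subsetI)
      fix S assume S: "S \<in> {S. S \<subseteq> {1..m} \<and> card S = 2}"
      then obtain a b where "S = {a, b}" "a \<noteq> b" by (auto simp: card_2_iff)
      then have "S = {min a b, max a b}" "(min a b, max a b) \<in> pairs"
        using S by (auto simp: pairs_def min_def max_def)
      then show "S \<in> (\<lambda>(a, b). {a, b}) ` pairs" by force
    qed (auto simp: pairs_def)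
  qed
  then have "card pairs = card {S. S \<subseteq> {1..m} \<and> card S = 2}"
    by (rule bij_betw_same_card)
  then show ?thesis by (simp add: n_subsets)
qed

lemma inj_on_swap_angle: "inj_on (swap_angle x) pairs"
proof (rule inj_onI)
  fix e e' assume e: "e \<in> pairs" "e' \<in> pairs" "swap_angle x e = swap_angle x e'"
  then have "slope (x (fst e)) (x (snd e)) = slope (x (fst e')) (x (snd e'))"
    by (simp add: swap_angle_def split_beta arctan_eq_iff)
  then show "e = e'"
    using e slopes_distinct [of "fst e" "snd e" "fst e'" "snd e'"]
    by (auto simp: pairs_def prod_eq_iff split_beta)
qed

text \<open>The inversions present at angle \<theta>. Strictness leaves a pair out at its own swap
  angle, so \<open>swap_count (swap_angle x e)\<close> is the zero-based position of the swap of
  \<open>e\<close> in the network.\<close>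

definition swapped :: "real \<Rightarrow> (nat \<times> nat) set" where
  "swapped \<theta> = {e \<in> pairs. swap_angle x e < \<theta>}"

definition swap_count :: "real \<Rightarrow> nat" where
  "swap_count \<theta> = card (swapped \<theta>)"

lemma finite_swapped [simp]: "finite (swapped \<theta>)"
  by (simp add: swapped_def)

lemma swapped_subset: "swapped \<theta> \<subseteq> pairs"
  by (auto simp: swapped_def)

lemma swap_count_le: "swap_count \<theta> \<le> card pairs"
  unfolding swap_count_def by (intro card_mono swapped_subset) simp

lemma swap_count_mono: "\<theta> \<le> \<theta>' \<Longrightarrow> swap_count \<theta> \<le> swap_count \<theta>'"
  unfolding swap_count_def swapped_def by (intro card_mono) auto

lemma swapped_eq_if_swap_count_eq: "swap_count \<theta> = swap_count \<theta>' \<Longrightarrow> swapped \<theta> = swapped \<theta>'"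
  unfolding swap_count_def swapped_def by (rule initial_segments_eq_if_card_eq) simp_all

text \<open>Only the pair at hand must not be swapping: \<theta> may be the swap angle of another
  pair, as in \<open>order_at_step\<close>.\<close>

lemma projection_less_iff_swapped:
  assumes "c \<in> {1..m}" "d \<in> {1..m}" "c \<noteq> d" "0 \<le> \<theta>" "\<theta> \<le> pi"
    and "swap_angle x (min c d, max c d) \<noteq> \<theta>"
  shows "projection x \<theta> c < projection x \<theta> d \<longleftrightarrow>
    (if c < d then (c, d) \<notin> swapped \<theta> else (d, c) \<in> swapped \<theta>)"
proof (cases "c < d")
  case True
  then show ?thesis
    using projection_less_iff(1)[of x c d \<theta>] fst_less[of c d] assms
    by (auto simp: swapped_def pairs_def min_def max_def)
next
  case False
  then show ?thesis
    using projection_less_iff(2)[of x d c \<theta>] fst_less[of d c] assms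
    by (auto simp: swapped_def pairs_def min_def max_def)
qed

definition regular :: "real set" where
  "regular = {0..pi} - swap_angle x ` pairs"

lemma inj_on_projection_iff:
  assumes \<theta>: "0 \<le> \<theta>" "\<theta> \<le> pi"
  shows "inj_on (projection x \<theta>) {1..m} \<longleftrightarrow> \<theta> \<notin> swap_angle x ` pairs"
proof
  assume inj: "inj_on (projection x \<theta>) {1..m}"
  show "\<theta> \<notin> swap_angle x ` pairs"
  proof
    assume "\<theta> \<in> swap_angle x ` pairs"
    then obtain a b where ab: "a \<in> {1..m}" "b \<in> {1..m}" "a < b" "\<theta> = swap_angle x (a, b)"
      by (auto simp: pairs_def)
    then have "projection x \<theta> a = projection x \<theta> b"
      using projection_less_iff[OF fst_less[OF ab(1-3)] \<theta>] by (meson linorder_neqE_linordered_idom less_irrefl)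
    then show False using inj ab by (auto dest: inj_onD)
  qed
next
  assume \<theta>': "\<theta> \<notin> swap_angle x ` pairs"
  have "projection x \<theta> a \<noteq> projection x \<theta> b" if ab: "a \<in> {1..m}" "b \<in> {1..m}" "a < b" for a b
  proof
    assume eq: "projection x \<theta> a = projection x \<theta> b"
    have "\<not> \<theta> < swap_angle x (a, b)" "\<not> swap_angle x (a, b) < \<theta>"
      using projection_less_iff[OF fst_less[OF ab] \<theta>] by (simp_all add: eq)
    then have "\<theta> = swap_angle x (a, b)" by linarith
    then show False using \<theta>' ab by (auto simp: pairs_def)
  qed
  then show "inj_on (projection x \<theta>) {1..m}"
    by (intro inj_onI) (metis linorder_neqE_nat)
qed

lemma inj_on_projection_regular: "\<theta> \<in> regular \<Longrightarrow> inj_on (projection x \<theta>) {1..m}"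
  using inj_on_projection_iff [of \<theta>] by (auto simp: regular_def)

lemma regular_angles_eq: "regular_angles m x = regular"
proof -
  have "(\<exists>\<sigma>. proj_order m x \<theta> \<sigma>) \<longleftrightarrow> inj_on (projection x \<theta>) {1..m}" for \<theta>
    using proj_order_iff inj_on_projection_if_proj_order by blast
  then show ?thesis
    using inj_on_projection_iff by (auto simp: regular_angles_def regular_def)
qed

definition order_at :: "real \<Rightarrow> nat \<Rightarrow> nat" where
  "order_at \<theta> = inv (value_rank m (projection x \<theta>))"

lemma proj_order_regular_iff: "\<theta> \<in> regular \<Longrightarrow> proj_order m x \<theta> \<sigma> \<longleftrightarrow> \<sigma> = order_at \<theta>"
  unfolding order_at_def by (rule proj_order_iff) (rule inj_on_projection_regular)

lemma projection_less_iff_regular: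
  assumes "c \<in> {1..m}" "d \<in> {1..m}" "c \<noteq> d" "\<theta> \<in> regular"
  shows "projection x \<theta> c < projection x \<theta> d \<longleftrightarrow>
    (if c < d then (c, d) \<notin> swapped \<theta> else (d, c) \<in> swapped \<theta>)"
proof (rule projection_less_iff_swapped)
  have "(min c d, max c d) \<in> pairs"
    using assms by (auto simp: pairs_def min_def max_def)
  then show "swap_angle x (min c d, max c d) \<noteq> \<theta>"
    using assms by (auto simp: regular_def)
qed (use assms in \<open>auto simp: regular_def\<close>)

lemma projection_le_iff:
  assumes "c \<in> {1..m}" "d \<in> {1..m}" "\<theta> \<in> regular"
  shows "projection x \<theta> c \<le> projection x \<theta> d \<longleftrightarrow> c = d \<or> projection x \<theta> c < projection x \<theta> d"
proof -
  have "inj_on (projection x \<theta>) {1..m}"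
    using assms(3) by (rule inj_on_projection_regular)
  then show ?thesis
    using assms(1,2) by (auto simp: le_less dest: inj_onD)
qed

text \<open>Equal counts mean equal sets of inversions, and these decide every comparison of
  projections.\<close>

lemma order_at_eq_if_swap_count_eq:
  assumes \<theta>: "\<theta> \<in> regular" "\<theta>' \<in> regular" and eq: "swap_count \<theta> = swap_count \<theta>'"
  shows "order_at \<theta> = order_at \<theta>'"
proof -
  have "projection x \<theta> c \<le> projection x \<theta> d \<longleftrightarrow> projection x \<theta>' c \<le> projection x \<theta>' d"
    if cd: "c \<in> {1..m}" "d \<in> {1..m}" for c d
    using projection_le_iff[OF cd \<theta>(1)] projection_le_iff[OF cd \<theta>(2)]
      projection_less_iff_regular[OF cd _ \<theta>(1)] projection_less_iff_regular[OF cd _ \<theta>(2)]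
      swapped_eq_if_swap_count_eq[OF eq] by (cases "c = d") simp_all
  then have "{c \<in> {1..m}. projection x \<theta> c \<le> projection x \<theta> a} =
      {c \<in> {1..m}. projection x \<theta>' c \<le> projection x \<theta>' a}" if "a \<in> {1..m}" for a
    using that by blast
  then have "value_rank m (projection x \<theta>) = value_rank m (projection x \<theta>')"
    unfolding value_rank_def by (intro ext if_cong refl arg_cong [where f = card])
  then show ?thesis by (simp add: order_at_def)
qed

lemma exists_regular_with_swap_count:
  assumes "t \<le> card pairs"
  shows "\<exists>\<theta>\<in>regular. swap_count \<theta> = t"
proof -
  let ?C = "swap_angle x ` pairs"
  have card: "card ?C = card pairs"
    by (rule card_image[OF inj_on_swap_angle])
  have "\<exists>\<theta>\<in>{0..pi} - ?C. card {c\<in>?C. c < \<theta>} = t"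
    using assms card by (intro exists_between_with_initial_card) (auto simp: swap_angle_bounds)
  moreover have "card {c\<in>?C. c < \<theta>} = swap_count \<theta>" for \<theta>
  proof -
    have "{c\<in>?C. c < \<theta>} = swap_angle x ` swapped \<theta>" by (auto simp: swapped_def)
    then show ?thesis
      unfolding swap_count_def
      using card_image[OF inj_on_subset[OF inj_on_swap_angle swapped_subset]] by simp
  qed
  ultimately show ?thesis by (auto simp: regular_def)
qed

text \<open>Distinct swap angles order the pairs strictly, so the counts number the swaps from 0
  without gaps.\<close>

lemma bij_betw_swap_count: "bij_betw (\<lambda>e. swap_count (swap_angle x e)) pairs {..<card pairs}"
proof -
  have less: "swap_count (swap_angle x e) < swap_count (swap_angle x e')"
    if "e \<in> pairs" "swap_angle x e < swap_angle x e'" for e e'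
    unfolding swap_count_def using that
    by (intro psubset_card_mono) (auto simp: swapped_def)
  have inj: "inj_on (\<lambda>e. swap_count (swap_angle x e)) pairs"
    by (rule inj_onI) (metis less inj_on_swap_angle inj_onD less_irrefl linorder_neqE_linordered_idom)
  have "swap_count (swap_angle x e) < card pairs" if "e \<in> pairs" for e
    unfolding swap_count_def using that by (intro psubset_card_mono) (auto simp: swapped_def)
  then have "(\<lambda>e. swap_count (swap_angle x e)) ` pairs \<subseteq> {..<card pairs}" by auto
  then show ?thesis
    using inj by (simp add: bij_betw_def card_image card_subset_eq)
qed

text \<open>At the swap angle the projections of \<open>a\<close> and \<open>b\<close> agree, and
  the points below their line are exactly those with smaller projection. So the two exchange the
  ranks \<open>card K + 1\<close> and \<open>card K + 2\<close>, and no other rank changes. The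
  transposition acts on ranks from the left, hence on the inverse \<open>order_at\<close> from the
  right, as in \<open>configuration_Suc\<close>.\<close>

lemma order_at_step:
  assumes \<theta>: "\<theta> \<in> regular" "\<theta>' \<in> regular" and e: "(a, b) \<in> pairs"
    and count: "swap_count \<theta> = swap_count (swap_angle x (a, b))"
      "swap_count \<theta>' = Suc (swap_count (swap_angle x (a, b)))"
  shows "order_at \<theta>' = order_at \<theta> \<circ> adj_transp (Suc (below_count {1..m} x a b))"
proof -
  let ?\<psi> = "swap_angle x (a, b)"
  have ab: "a \<in> {1..m}" "b \<in> {1..m}" "a < b" using e by (auto simp: pairs_def)
  have \<psi>: "0 \<le> ?\<psi>" "?\<psi> \<le> pi" using swap_angle_bounds[of x "(a, b)"] by auto
  have S: "swapped \<theta> = swapped ?\<psi>"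
    using count(1) by (rule swapped_eq_if_swap_count_eq)
  have "?\<psi> < \<theta>'"
    using count(2) swap_count_mono[of \<theta>' ?\<psi>] by linarith
  then have "insert (a, b) (swapped ?\<psi>) \<subseteq> swapped \<theta>'"
    using e by (auto simp: swapped_def)
  moreover have ab_notin: "(a, b) \<notin> swapped ?\<psi>" by (simp add: swapped_def)
  \<comment> \<open>The inclusion is an equality because both sides have the same size: only
    \<open>(a, b)\<close> has been swapped in between.\<close>
  ultimately have S': "swapped \<theta>' = insert (a, b) (swapped ?\<psi>)"
    using count(2) by (intro card_subset_eq[symmetric]) (simp_all add: swap_count_def)
  have \<psi>_less: "projection x ?\<psi> c < projection x ?\<psi> d \<longleftrightarrow>
      (if c < d then (c, d) \<notin> swapped ?\<psi> else (d, c) \<in> swapped ?\<psi>)"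
    if "c \<in> {1..m}" "d \<in> {1..m}" "c \<noteq> d" "{c, d} \<noteq> {a, b}" for c d
  proof (rule projection_less_iff_swapped)
    have "(min c d, max c d) \<in> pairs" "(min c d, max c d) \<noteq> (a, b)"
      using that ab by (auto simp: pairs_def min_def max_def)
    then show "swap_angle x (min c d, max c d) \<noteq> ?\<psi>"
      using inj_on_swap_angle e by (auto dest: inj_onD)
  qed (use that \<psi> in auto)
  define K where "K = {c \<in> {1..m} - {a, b}. x c \<in> below_line (slope (x a) (x b)) (intercept (x a) (x b))}"
  have finK: "finite K" "a \<notin> K" "b \<notin> K" by (auto simp: K_def)
  have K_iff: "c \<in> K \<longleftrightarrow> projection x ?\<psi> c < projection x ?\<psi> a" "c \<in> K \<longleftrightarrow> projection x ?\<psi> c < projection x ?\<psi> b"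
    if c: "c \<in> {1..m} - {a, b}" for c
  proof -
    show *: "c \<in> K \<longleftrightarrow> projection x ?\<psi> c < projection x ?\<psi> a"
      using below_line_iff_projection[of ?\<psi> x a b c, OF sin_swap_angle_pos cos_swap_angle] c
      by (simp add: K_def)
    have "projection x ?\<psi> a = projection x ?\<psi> b"
      using projection_less_iff[OF fst_less[OF ab] \<psi>] by (meson linorder_neqE_linordered_idom less_irrefl)
    then show "c \<in> K \<longleftrightarrow> projection x ?\<psi> c < projection x ?\<psi> b"
      using * by simp
  qed
  \<comment> \<open>The swap angle itself serves as reference: on either side of it only the
    comparison of \<open>a\<close> with \<open>b\<close> differs.\<close>
  have unchanged: "projection x \<theta> c < projection x \<theta> d \<longleftrightarrow> projection x ?\<psi> c < projection x ?\<psi> d"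
    "projection x \<theta>' c < projection x \<theta>' d \<longleftrightarrow> projection x ?\<psi> c < projection x ?\<psi> d"
    if cd: "c \<in> {1..m}" "d \<in> {1..m}" "c \<noteq> d" "{c, d} \<noteq> {a, b}" for c d
    using projection_less_iff_regular[OF cd(1-3) \<theta>(1)] projection_less_iff_regular[OF cd(1-3) \<theta>(2)]
      \<psi>_less[OF cd] S S' cd(4) by (auto simp: insert_commute)
  have low: "projection x \<theta> a < projection x \<theta> b" "\<not> projection x \<theta> b < projection x \<theta> a"
    using projection_less_iff_regular[OF ab(1,2) _ \<theta>(1)] ab S ab_notin by auto
  have high: "\<not> projection x \<theta>' a < projection x \<theta>' b" "projection x \<theta>' b < projection x \<theta>' a"
    using projection_less_iff_regular[OF ab(1,2) _ \<theta>(2)]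
      projection_less_iff_regular[OF ab(2,1) _ \<theta>(2)] ab S' by auto
  let ?r = "value_rank m (projection x \<theta>)" and ?r' = "value_rank m (projection x \<theta>')"
  have sets: "{c \<in> {1..m}. projection x \<theta> c \<le> projection x \<theta> a} = insert a K"
    "{c \<in> {1..m}. projection x \<theta> c \<le> projection x \<theta> b} = insert a (insert b K)"
    "{c \<in> {1..m}. projection x \<theta>' c \<le> projection x \<theta>' a} = insert a (insert b K)"
    "{c \<in> {1..m}. projection x \<theta>' c \<le> projection x \<theta>' b} = insert b K"
  proof -
    have K: "K \<subseteq> {1..m} - {a, b}" by (auto simp: K_def)
    have iff: "projection x \<theta> c < projection x \<theta> a \<longleftrightarrow> c \<in> K"
      "projection x \<theta> c < projection x \<theta> b \<longleftrightarrow> c \<in> K"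
      "projection x \<theta>' c < projection x \<theta>' a \<longleftrightarrow> c \<in> K"
      "projection x \<theta>' c < projection x \<theta>' b \<longleftrightarrow> c \<in> K"
      if c: "c \<in> {1..m}" "c \<noteq> a" "c \<noteq> b" for c
      using unchanged[of c a] unchanged[of c b] K_iff[of c] c ab by (auto simp: doubleton_eq_iff)
    show "{c \<in> {1..m}. projection x \<theta> c \<le> projection x \<theta> a} = insert a K"
      "{c \<in> {1..m}. projection x \<theta> c \<le> projection x \<theta> b} = insert a (insert b K)"
      using K ab low iff projection_le_iff[OF _ ab(1) \<theta>(1)] projection_le_iff[OF _ ab(2) \<theta>(1)]
      by blast+
    show "{c \<in> {1..m}. projection x \<theta>' c \<le> projection x \<theta>' a} = insert a (insert b K)"
      "{c \<in> {1..m}. projection x \<theta>' c \<le> projection x \<theta>' b} = insert b K"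
      using K ab high iff projection_le_iff[OF _ ab(1) \<theta>(2)] projection_le_iff[OF _ ab(2) \<theta>(2)]
      by blast+
  qed
  have bc: "below_count {1..m} x a b = card K"
    by (simp add: below_count_def K_def)
  have ranks: "?r a = Suc (card K)" "?r b = Suc (Suc (card K))"
    "?r' a = Suc (Suc (card K))" "?r' b = Suc (card K)"
    using ab finK unfolding value_rank_def sets by auto
  have perm: "?r permutes {1..m}" "?r' permutes {1..m}"
    using \<theta> by (auto intro!: value_rank_permutes inj_on_projection_regular simp del: One_nat_def)
  have "?r' c = adj_transp (Suc (card K)) (?r c)" for c
  proof (cases "c \<in> {a, b}")
    case True
    then show ?thesis by (auto simp: ranks adj_transp_def)
  next
    case False
    have "?r' c = ?r c"
    proof (cases "c \<in> {1..m}")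
      case c: True
      have "projection x \<theta> d \<le> projection x \<theta> c \<longleftrightarrow> projection x \<theta>' d \<le> projection x \<theta>' c"
        if d: "d \<in> {1..m}" for d
        using unchanged[of d c] False projection_le_iff[OF d c \<theta>(1)] projection_le_iff[OF d c \<theta>(2)] c d
        by (auto simp: doubleton_eq_iff)
      then have "{d \<in> {1..m}. projection x \<theta> d \<le> projection x \<theta> c} =
          {d \<in> {1..m}. projection x \<theta>' d \<le> projection x \<theta>' c}" by blast
      then show ?thesis by (simp add: value_rank_def)
    next
      case False
      then show ?thesis by (simp only: value_rank_def if_False)
    qed
    moreover have "?r c \<noteq> ?r a" "?r c \<noteq> ?r b"
      using False permutes_inj[OF perm(1)] by (auto dest: injD)
    ultimately show ?thesis
      by (simp add: ranks adj_transp_def Transposition.transpose_def)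
  qed
  then have "?r' = adj_transp (Suc (card K)) \<circ> ?r" by auto
  then have "inv ?r' = inv ?r \<circ> inv (adj_transp (Suc (card K)))"
    using permutes_bij[OF perm(1)] by (simp add: o_inv_distrib adj_transp_def)
  moreover have "inv (adj_transp i) = adj_transp i" for i
    by (simp add: adj_transp_def)
  ultimately show ?thesis
    unfolding order_at_def bc by (simp only:)
qed

lemma regular_0: "0 \<in> regular" and regular_pi: "pi \<in> regular"
  using swap_angle_bounds(1) [of x] swap_angle_bounds(2) [of x]
  by (auto simp: regular_def image_iff) (metis less_irrefl)+

lemma swap_count_0: "swap_count 0 = 0"
proof -
  have "swapped 0 = {}" by (auto simp: swapped_def not_less intro!: less_imp_le swap_angle_bounds)
  then show ?thesis by (simp add: swap_count_def)
qed

lemma swap_count_pi: "swap_count pi = card pairs"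
proof -
  have "swapped pi = pairs" using swap_angle_bounds by (auto simp: swapped_def)
  then show ?thesis by (simp add: swap_count_def)
qed

lemma order_at_0: "order_at 0 = id"
proof -
  have "proj_order m x 0 id"
    unfolding proj_order_def
    by (auto simp: permutes_id inner_prod_def intro!: strict_mono_onI fst_less)
  then show ?thesis using proj_order_regular_iff[OF regular_0] by simp
qed

lemma order_at_pi: "order_at pi = reverse_perm m"
proof -
  have "reverse_perm m permutes {1..m}"
  proof (rule bij_imp_permutes)
    show "bij_betw (reverse_perm m) {1..m} {1..m}"
      by (rule bij_betw_byWitness[where f' = "reverse_perm m"]) (auto simp: reverse_perm_def)
  qed (auto simp: reverse_perm_def)
  moreover have "strict_mono_on {1..m} (\<lambda>i. projection x pi (reverse_perm m i))"
  proof (rule strict_mono_onI)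
    fix i j assume "i \<in> {1..m}" "j \<in> {1..m}" "i < j"
    then show "projection x pi (reverse_perm m i) < projection x pi (reverse_perm m j)"
      using fst_less [of "m + 1 - j" "m + 1 - i"] by (auto simp: inner_prod_def reverse_perm_def)
  qed
  ultimately have "proj_order m x pi (reverse_perm m)"
    by (simp add: proj_order_def)
  then show ?thesis using proj_order_regular_iff[OF regular_pi] by simp
qed

text \<open>The counting function in the definition is forced. Between two swaps it cannot move,
  since a step would multiply the configuration by a transposition while the order stays the same.
  So it factors through the swap count as a monotone map of \<open>{0..card pairs}\<close> onto
  itself, which is the identity.\<close>

lemma geometric_network_counts:
  assumes s: "length s = card pairs"
    and k: "mono_on regular k" "k ` regular = {0..length s}"
    and ord: "\<And>\<theta>. \<theta> \<in> regular \<Longrightarrow> order_at \<theta> = configuration s (k \<theta>)"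
    and \<theta>: "\<theta> \<in> regular"
  shows "k \<theta> = swap_count \<theta>"
proof -
  have const: "k \<theta>1 = k \<theta>2" if \<theta>12: "\<theta>1 \<in> regular" "\<theta>2 \<in> regular" "\<theta>1 \<le> \<theta>2" "swap_count \<theta>1 = swap_count \<theta>2"
    for \<theta>1 \<theta>2
  proof (rule ccontr)
    assume "k \<theta>1 \<noteq> k \<theta>2"
    then have less: "k \<theta>1 < k \<theta>2"
      using mono_onD[OF k(1) \<theta>12(1-3)] by simp
    have "k \<theta>2 \<le> length s" using k(2) \<theta>12(2) by auto
    then have "Suc (k \<theta>1) \<in> k ` regular" using k(2) less by simp
    then obtain \<theta>3 where \<theta>3: "\<theta>3 \<in> regular" "k \<theta>3 = Suc (k \<theta>1)" by auto
    \<comment> \<open>Truncation at \<theta>2 keeps the angle within the gap; if \<theta>3 lies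
      beyond, monotonicity squeezes \<open>k \<theta>2\<close> to the same value.\<close>
    define \<theta>4 where "\<theta>4 = min \<theta>3 \<theta>2"
    have "k \<theta>4 = Suc (k \<theta>1)"
    proof (cases "\<theta>3 \<le> \<theta>2")
      case False
      then have "k \<theta>2 \<le> k \<theta>3" using mono_onD[OF k(1) \<theta>12(2) \<theta>3(1)] by simp
      then show ?thesis using False \<theta>3 less by (simp add: \<theta>4_def)
    qed (simp add: \<theta>4_def \<theta>3)
    moreover have \<theta>4: "\<theta>4 \<in> regular" "\<theta>4 \<le> \<theta>2" using \<theta>3 \<theta>12 by (auto simp: \<theta>4_def min_def)
    ultimately have "\<theta>1 \<le> \<theta>4"
      using mono_onD[OF k(1) \<theta>4(1) \<theta>12(1)] by linarith
    then have "swap_count \<theta>4 = swap_count \<theta>1"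
      using swap_count_mono[of \<theta>1 \<theta>4] swap_count_mono[of \<theta>4 \<theta>2] \<theta>4 \<theta>12 by simp
    then have "configuration s (Suc (k \<theta>1)) = configuration s (k \<theta>1)"
      using order_at_eq_if_swap_count_eq[OF \<theta>4(1) \<theta>12(1)] ord[OF \<theta>4(1)] ord[OF \<theta>12(1)]
        \<open>k \<theta>4 = Suc (k \<theta>1)\<close> by simp
    moreover have "k \<theta>1 < length s" using less \<open>k \<theta>2 \<le> length s\<close> by simp
    ultimately have "configuration s (k \<theta>1) \<circ> adj_transp (s ! k \<theta>1) = configuration s (k \<theta>1) \<circ> id"
      by (simp add: configuration_Suc)
    then have "adj_transp (s ! k \<theta>1) = id"
      using bij_configuration by (metis bij_is_inj fun.inj_map injD)
    then show False using adj_transp_neq_id by simp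
  qed
  \<comment> \<open>A representative regular angle for each gap between swaps.\<close>
  define angle where "angle t = (SOME \<theta>. \<theta> \<in> regular \<and> swap_count \<theta> = t)" for t
  have angle: "angle t \<in> regular" "swap_count (angle t) = t" if "t \<le> card pairs" for t
    using someI_ex[of "\<lambda>\<theta>. \<theta> \<in> regular \<and> swap_count \<theta> = t"] exists_regular_with_swap_count[OF that]
    by (auto simp: angle_def)
  define h where "h t = k (angle t)" for t
  have kh: "k \<theta> = h (swap_count \<theta>)" if "\<theta> \<in> regular" for \<theta>
    using const[OF that angle(1)] const[OF angle(1) that] angle(2) swap_count_le
    unfolding h_def by (metis linear)
  have "h ` {0..card pairs} = {0..card pairs}"
  proof -
    have "{0..card pairs} = k ` regular" using k(2) s by simp
    also have "\<dots> = h ` {0..card pairs}"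
    proof (intro equalityI subsetI)
      fix y assume "y \<in> k ` regular"
      then show "y \<in> h ` {0..card pairs}" using kh swap_count_le by auto
    next
      fix y assume "y \<in> h ` {0..card pairs}"
      then show "y \<in> k ` regular" using angle(1) by (auto simp: h_def)
    qed
    finally show ?thesis ..
  qed
  then have inj: "inj_on h {0..card pairs}" and hM: "h (card pairs) \<le> card pairs"
    by (auto intro: eq_card_imp_inj_on)
  have "h t < h t'" if "t < t'" "t' \<le> card pairs" for t t'
  proof -
    have "angle t \<le> angle t'"
      using that angle(2)[of t] angle(2)[of t'] swap_count_mono[of "angle t'" "angle t"] by linarith
    then have "h t \<le> h t'"
      using mono_onD[OF k(1) angle(1) angle(1)] that by (simp add: h_def)
    moreover have "h t \<noteq> h t'" using inj that by (auto dest: inj_onD)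
    ultimately show ?thesis by simp
  qed
  then have "h (swap_count \<theta>) = swap_count \<theta>"
    using hM swap_count_le by (rule strict_mono_nat_eq_id)
  then show ?thesis using kh[OF \<theta>] by simp
qed

text \<open>Forward, consecutive configurations are compared and the bijective prefix is cancelled;
  conversely, \<open>swap_count\<close> serves as the counting function. As the positions are in
  bijection with the pairs, this form prescribes every entry of the list.\<close>

lemma is_geometric_network_iff:
  "is_geometric_network m x s \<longleftrightarrow> length s = card pairs \<and>
    (\<forall>(a, b)\<in>pairs. s ! swap_count (swap_angle x (a, b)) = Suc (below_count {1..m} x a b))"
proof
  assume geo: "is_geometric_network m x s"
  then have len: "length s = card pairs"
    by (simp add: is_geometric_network_def sorting_network_def card_pairs)
  obtain k where k: "mono_on regular k" "k ` regular = {0..length s}"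
    "\<And>\<theta>. \<theta> \<in> regular \<Longrightarrow> proj_order m x \<theta> (configuration s (k \<theta>))"
    using geo unfolding is_geometric_network_def regular_angles_eq by blast
  have ord: "order_at \<theta> = configuration s (k \<theta>)" if "\<theta> \<in> regular" for \<theta>
    using k(3)[OF that] proj_order_regular_iff[OF that] by simp
  have conf: "order_at \<theta> = configuration s (swap_count \<theta>)" if "\<theta> \<in> regular" for \<theta>
    using geometric_network_counts[OF len k(1,2) ord that] ord[OF that] by simp
  have "s ! swap_count (swap_angle x (a, b)) = Suc (below_count {1..m} x a b)" if e: "(a, b) \<in> pairs" for a b
  proof -
    let ?t = "swap_count (swap_angle x (a, b))"
    have t: "?t < card pairs"
      using bij_betw_apply[OF bij_betw_swap_count e] by simp
    obtain \<theta> where \<theta>: "\<theta> \<in> regular" "swap_count \<theta> = ?t"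
      using exists_regular_with_swap_count[of ?t] t by auto
    obtain \<theta>' where \<theta>': "\<theta>' \<in> regular" "swap_count \<theta>' = Suc ?t"
      using exists_regular_with_swap_count[of "Suc ?t"] t by auto
    have "configuration s ?t \<circ> adj_transp (s ! ?t) =
        configuration s ?t \<circ> adj_transp (Suc (below_count {1..m} x a b))"
      using order_at_step[OF \<theta>(1) \<theta>'(1) e \<theta>(2) \<theta>'(2)] conf[OF \<theta>(1)] conf[OF \<theta>'(1)] \<theta>(2) \<theta>'(2)
        configuration_Suc[of ?t s] t len by simp
    then have "adj_transp (s ! ?t) = adj_transp (Suc (below_count {1..m} x a b))"
      using bij_configuration by (metis bij_is_inj fun.inj_map injD)
    then show ?thesis by (simp add: adj_transp_eq_iff)
  qed
  then show "length s = card pairs \<and>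
    (\<forall>(a, b)\<in>pairs. s ! swap_count (swap_angle x (a, b)) = Suc (below_count {1..m} x a b))"
    using len by auto
next
  assume "length s = card pairs \<and>
    (\<forall>(a, b)\<in>pairs. s ! swap_count (swap_angle x (a, b)) = Suc (below_count {1..m} x a b))"
  then have len: "length s = card pairs"
    and s: "\<And>a b. (a, b) \<in> pairs \<Longrightarrow> s ! swap_count (swap_angle x (a, b)) = Suc (below_count {1..m} x a b)"
    by auto
  have ex_pair: "\<exists>a b. (a, b) \<in> pairs \<and> swap_count (swap_angle x (a, b)) = t" if "t < card pairs" for t
  proof -
    have "t \<in> (\<lambda>e. swap_count (swap_angle x e)) ` pairs"
      using bij_betw_imp_surj_on[OF bij_betw_swap_count] that by simp
    then show ?thesis by force
  qed
  have conf: "\<forall>\<theta>\<in>regular. swap_count \<theta> = t \<longrightarrow> order_at \<theta> = configuration s t" if "t \<le> card pairs" for t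
    using that
  proof (induction t)
    case 0
    show ?case
      using order_at_eq_if_swap_count_eq[OF _ regular_0] by (auto simp: order_at_0 swap_count_0)
  next
    case (Suc t)
    obtain a b where ab: "(a, b) \<in> pairs" "swap_count (swap_angle x (a, b)) = t"
      using ex_pair[of t] Suc.prems by auto
    obtain \<theta>0 where \<theta>0: "\<theta>0 \<in> regular" "swap_count \<theta>0 = t"
      using exists_regular_with_swap_count[of t] Suc.prems by auto
    show ?case
    proof (intro ballI impI)
      fix \<theta> assume \<theta>: "\<theta> \<in> regular" "swap_count \<theta> = Suc t"
      have "order_at \<theta> = order_at \<theta>0 \<circ> adj_transp (s ! t)"
        using order_at_step[OF \<theta>0(1) \<theta>(1) ab(1)] ab(2) \<theta>0(2) \<theta>(2) s[OF ab(1)] by simp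
      also have "order_at \<theta>0 = configuration s t"
        using Suc \<theta>0 by simp
      also have "configuration s t \<circ> adj_transp (s ! t) = configuration s (Suc t)"
        using Suc.prems len by (intro configuration_Suc [symmetric]) simp
      finally show "order_at \<theta> = configuration s (Suc t)" .
    qed
  qed
  have "set s \<subseteq> {1..m - 1}"
  proof
    fix i assume "i \<in> set s"
    then obtain t where t: "t < card pairs" "i = s ! t" using len by (auto simp: in_set_conv_nth)
    obtain a b where ab: "(a, b) \<in> pairs" "swap_count (swap_angle x (a, b)) = t"
      using ex_pair[OF t(1)] by auto
    have "below_count {1..m} x a b \<le> card ({1..m} - {a, b})"
      unfolding below_count_def by (intro card_mono) auto
    also have "\<dots> = m - 2"
      using ab(1) by (subst card_Diff_subset) (auto simp: pairs_def)
    finally have "below_count {1..m} x a b \<le> m - 2" .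
    moreover have "2 \<le> m" using ab(1) by (auto simp: pairs_def)
    ultimately show "i \<in> {1..m - 1}" using s[OF ab(1)] t ab by auto
  qed
  moreover have "configuration s (length s) = reverse_perm m"
    using bspec [OF conf [OF order_refl] regular_pi] len order_at_pi swap_count_pi by simp
  ultimately have "sorting_network m s"
    by (simp add: sorting_network_def len card_pairs)
  moreover have "swap_count ` regular = {0..length s}"
    using exists_regular_with_swap_count swap_count_le len by (auto simp: image_iff) metis
  moreover have "mono_on regular swap_count"
    by (intro mono_onI swap_count_mono)
  moreover have "\<forall>\<theta>\<in>regular. proj_order m x \<theta> (configuration s (swap_count \<theta>))"
  proof
    fix \<theta> assume \<theta>: "\<theta> \<in> regular"
    then have "order_at \<theta> = configuration s (swap_count \<theta>)"
      using conf [OF swap_count_le] by blast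
    then show "proj_order m x \<theta> (configuration s (swap_count \<theta>))"
      using proj_order_regular_iff [OF \<theta>] by simp
  qed
  ultimately show "is_geometric_network m x s"
    unfolding is_geometric_network_def regular_angles_eq by blast
qed

text \<open>Inverting the numbering of pairs by swap time yields a list with the prescribed entries;
  any other network has the same entries, so the definite description denotes this list.\<close>

lemma swaps_at_geometric_network_sorted:
  "swaps_at (THE s. is_geometric_network m x s) (Suc n) =
    card {(a, b) \<in> pairs. below_count {1..m} x a b = n}"
proof -
  let ?time = "\<lambda>e. swap_count (swap_angle x e)"
  define pair where "pair = inv_into pairs ?time"
  have pair: "pair (?time e) = e" if "e \<in> pairs" for e
    using inv_into_f_f [OF bij_betw_imp_inj_on [OF bij_betw_swap_count] that] by (simp add: pair_def)
  define s where "s = map (\<lambda>t. Suc (case pair t of (a, b) \<Rightarrow> below_count {1..m} x a b)) [0..<card pairs]"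
  have time_less: "?time e < card pairs" if "e \<in> pairs" for e
    using bij_betw_apply[OF bij_betw_swap_count that] by simp
  have len: "length s = card pairs" by (simp add: s_def)
  have s_nth: "s ! ?time (a, b) = Suc (below_count {1..m} x a b)" if "(a, b) \<in> pairs" for a b
    using that time_less[OF that] by (simp add: s_def pair)
  have geo: "is_geometric_network m x s"
    unfolding is_geometric_network_iff using len s_nth by auto
  have "s' = s" if "is_geometric_network m x s'" for s'
  proof (rule nth_equalityI)
    show "length s' = length s" using that len by (simp add: is_geometric_network_iff)
    fix t assume "t < length s'"
    then have "t \<in> ?time ` pairs"
      using that bij_betw_imp_surj_on[OF bij_betw_swap_count] by (simp add: is_geometric_network_iff)
    then obtain a b where "(a, b) \<in> pairs" "t = ?time (a, b)" by auto
    then show "s' ! t = s ! t"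
      using that s_nth by (auto simp: is_geometric_network_iff)
  qed
  with geo have the: "(THE s. is_geometric_network m x s) = s" by (rule the_equality)
  have "bij_betw ?time {(a, b) \<in> pairs. below_count {1..m} x a b = n} {t. t < length s \<and> s ! t = Suc n}"
    unfolding bij_betw_def
  proof
    show "inj_on ?time {(a, b) \<in> pairs. below_count {1..m} x a b = n}"
      using bij_betw_imp_inj_on[OF bij_betw_swap_count] by (rule inj_on_subset) auto
    show "?time ` {(a, b) \<in> pairs. below_count {1..m} x a b = n} = {t. t < length s \<and> s ! t = Suc n}"
    proof (intro equalityI subsetI)
      fix t assume "t \<in> {t. t < length s \<and> s ! t = Suc n}"
      then have t: "t < card pairs" "s ! t = Suc n" using len by auto
      then have "t \<in> ?time ` pairs"
        using bij_betw_imp_surj_on[OF bij_betw_swap_count] by simp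
      then obtain a b where ab: "(a, b) \<in> pairs" "t = ?time (a, b)" by auto
      then have "below_count {1..m} x a b = n" using s_nth t by simp
      then show "t \<in> ?time ` {(a, b) \<in> pairs. below_count {1..m} x a b = n}"
        using ab by blast
    qed (use len s_nth time_less in auto)
  qed
  then show ?thesis
    unfolding the swaps_at_def by (rule bij_betw_same_card [symmetric])
qed

end

section \<open>Relabelling and the expectation\<close>

lemma x_ordered_permutation:
  assumes "inj_on (\<lambda>i. fst (p i)) {1..m}"
  obtains \<pi> where "\<pi> permutes {1..m}" "strict_mono_on {1..m} (\<lambda>i. fst (p (\<pi> i)))" "x_ordered m p = p \<circ> \<pi>"
proof
  let ?\<pi> = "inv (value_rank m (\<lambda>i. fst (p i)))"
  have perm: "?\<pi> permutes {1..m}"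
    using permutes_inv [OF value_rank_permutes [OF assms]] .
  then show "?\<pi> permutes {1..m}" .
  show mono: "strict_mono_on {1..m} (\<lambda>i. fst (p (?\<pi> i)))"
    using strict_mono_on_permuted_iff [OF assms perm] by simp
  have "(THE \<pi>. \<pi> permutes {1..m} \<and> strict_mono_on {1..m} (\<lambda>i. fst (p (\<pi> i)))) = ?\<pi>"
    by (rule the_equality) (use perm mono strict_mono_on_permuted_iff [OF assms] in blast)+
  then show "x_ordered m p = p \<circ> ?\<pi>"
    by (simp only: x_ordered_def)
qed

text \<open>Relabelling moves neither the line nor the points, so \<pi> maps one index set
  bijectively onto the other.\<close>

lemma below_count_permuted:
  assumes \<pi>: "\<pi> permutes I"
  shows "below_count I (p \<circ> \<pi>) a b = below_count I p (\<pi> a) (\<pi> b)"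
proof -
  let ?L = "below_line (slope (p (\<pi> a)) (p (\<pi> b))) (intercept (p (\<pi> a)) (p (\<pi> b)))"
  have "{c \<in> I - {\<pi> a, \<pi> b}. p c \<in> ?L} = \<pi> ` {c \<in> I - {a, b}. p (\<pi> c) \<in> ?L}"
  proof (intro equalityI subsetI)
    fix c assume c: "c \<in> {c \<in> I - {\<pi> a, \<pi> b}. p c \<in> ?L}"
    then obtain l where "l \<in> I" "c = \<pi> l" using permutes_image [OF \<pi>] by blast
    then show "c \<in> \<pi> ` {c \<in> I - {a, b}. p (\<pi> c) \<in> ?L}" using c by auto
  next
    fix c assume "c \<in> \<pi> ` {c \<in> I - {a, b}. p (\<pi> c) \<in> ?L}"
    then show "c \<in> {c \<in> I - {\<pi> a, \<pi> b}. p c \<in> ?L}"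
      using permutes_in_image [OF \<pi>] permutes_inj [OF \<pi>] by (auto dest: injD)
  qed
  then show ?thesis
    using \<pi> by (simp add: below_count_def card_image permutes_inj_on)
qed

text \<open>The sorting permutation carries pairs of sorted labels to pairs of original labels
  ordered by abscissa, so the right-hand side no longer mentions the sorting.\<close>

lemma swaps_at_geometric_network:
  assumes gp: "general_position m p"
  shows "swaps_at (geometric_network m p) (Suc n) = card (pairs_above {1..m} n p)"
proof -
  have fst_neq: "fst (p a) \<noteq> fst (p b)" if "a \<in> {1..m}" "b \<in> {1..m}" "a \<noteq> b" for a b
    using gp that unfolding general_position_iff by blast
  have cross: "cross_product (p b - p a) (p d - p c) \<noteq> 0"
    if "a \<in> {1..m}" "b \<in> {1..m}" "c \<in> {1..m}" "d \<in> {1..m}" "a \<noteq> b" "c \<noteq> d" "{a, b} \<noteq> {c, d}"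
    for a b c d
    using conjunct2 [OF gp [unfolded general_position_iff]] that by blast
  have "inj_on (\<lambda>i. fst (p i)) {1..m}"
    by (rule inj_onI) (use fst_neq in blast)
  then obtain \<pi> where \<pi>: "\<pi> permutes {1..m}" "strict_mono_on {1..m} (\<lambda>i. fst (p (\<pi> i)))"
    "x_ordered m p = p \<circ> \<pi>"
    by (rule x_ordered_permutation)
  have in_m: "\<pi> a \<in> {1..m} \<longleftrightarrow> a \<in> {1..m}" for a
    by (rule permutes_in_image [OF \<pi>(1)])
  have \<pi>_eq: "\<pi> a = \<pi> b \<longleftrightarrow> a = b" for a b
    using permutes_inj [OF \<pi>(1)] by (auto dest: injD)
  interpret sorted_points m "p \<circ> \<pi>"
  proof
    fix a b assume "a \<in> {1..m}" "b \<in> {1..m}" "a < b"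
    then show "fst ((p \<circ> \<pi>) a) < fst ((p \<circ> \<pi>) b)"
      using strict_mono_onD [OF \<pi>(2)] by simp
  next
    fix a b c d
    assume abcd: "a \<in> {1..m}" "b \<in> {1..m}" "c \<in> {1..m}" "d \<in> {1..m}" "a < b" "c < d"
      and slope: "slope ((p \<circ> \<pi>) a) ((p \<circ> \<pi>) b) = slope ((p \<circ> \<pi>) c) ((p \<circ> \<pi>) d)"
    have "fst (p (\<pi> b)) - fst (p (\<pi> a)) \<noteq> 0" "fst (p (\<pi> d)) - fst (p (\<pi> c)) \<noteq> 0"
      using fst_neq [of "\<pi> b" "\<pi> a"] fst_neq [of "\<pi> d" "\<pi> c"] abcd in_m \<pi>_eq by auto
    then have "cross_product (p (\<pi> b) - p (\<pi> a)) (p (\<pi> d) - p (\<pi> c)) = 0"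
      using slope by (simp add: slope_def cross_product_def frac_eq_eq mult.commute)
    then have "{\<pi> a, \<pi> b} = {\<pi> c, \<pi> d}"
      using cross [of "\<pi> a" "\<pi> b" "\<pi> c" "\<pi> d"] abcd in_m \<pi>_eq by auto
    then show "a = c \<and> b = d"
      using abcd by (auto simp: doubleton_eq_iff \<pi>_eq)
  qed
  have less_iff: "fst (p (\<pi> a)) < fst (p (\<pi> b)) \<longleftrightarrow> a < b" if "a \<in> {1..m}" "b \<in> {1..m}" for a b
    using fst_less [of a b] fst_less [of b a] that by (cases a b rule: linorder_cases) auto
  have "swaps_at (geometric_network m p) (Suc n) =
      card {(a, b) \<in> pairs. below_count {1..m} (p \<circ> \<pi>) a b = n}"
    using gp swaps_at_geometric_network_sorted by (simp add: geometric_network_def \<pi>(3))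
  also have "\<dots> = card (map_prod \<pi> \<pi> ` {(a, b) \<in> pairs. below_count {1..m} (p \<circ> \<pi>) a b = n})"
    by (rule card_image [symmetric]) (auto simp: inj_on_def \<pi>_eq)
  also have "map_prod \<pi> \<pi> ` {(a, b) \<in> pairs. below_count {1..m} (p \<circ> \<pi>) a b = n} = pairs_above {1..m} n p"
  proof (intro equalityI subsetI)
    fix e assume "e \<in> map_prod \<pi> \<pi> ` {(a, b) \<in> pairs. below_count {1..m} (p \<circ> \<pi>) a b = n}"
    then obtain a b where "e = (\<pi> a, \<pi> b)" "(a, b) \<in> pairs" "below_count {1..m} (p \<circ> \<pi>) a b = n"
      by auto
    then show "e \<in> pairs_above {1..m} n p"
      unfolding below_count_permuted [OF \<pi>(1)] pairs_def pairs_above_def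
      using in_m less_iff by blast
  next
    fix e assume "e \<in> pairs_above {1..m} n p"
    then obtain a b where e: "e = (a, b)" "a \<in> {1..m}" "b \<in> {1..m}" "fst (p a) < fst (p b)"
      "below_count {1..m} p a b = n"
      by (auto simp: pairs_above_def)
    obtain a' b' where ab': "a = \<pi> a'" "b = \<pi> b'"
      using permutes_surj [OF \<pi>(1)] by (meson surjD)
    have "a' \<in> {1..m}" "b' \<in> {1..m}" "a' < b'" "below_count {1..m} (p \<circ> \<pi>) a' b' = n"
      using e in_m less_iff by (auto simp only: ab' below_count_permuted [OF \<pi>(1)])
    then have "(a', b') \<in> {(a, b) \<in> pairs. below_count {1..m} (p \<circ> \<pi>) a b = n}"
      by (simp add: pairs_def)
    then show "e \<in> map_prod \<pi> \<pi> ` {(a, b) \<in> pairs. below_count {1..m} (p \<circ> \<pi>) a b = n}"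
      unfolding e(1) ab' by (rule rev_image_eqI) simp
  qed
  finally show ?thesis .
qed

text \<open>To enter the product space, the random family is restricted to \<open>{1..m}\<close> and
  becomes \<open>undefined\<close> elsewhere; this lemma and the next make that harmless.\<close>

lemma general_position_cong:
  assumes "\<And>i. i \<in> {1..m} \<Longrightarrow> p i = q i"
  shows "general_position m p \<longleftrightarrow> general_position m q"
  unfolding general_position_iff using assms by (simp cong: ball_cong del: atLeastAtMost_iff)

lemma pairs_above_cong:
  assumes "\<And>i. i \<in> I \<Longrightarrow> p i = q i"
  shows "pairs_above I n p = pairs_above I n q"
proof -
  have "below_count I p a b = below_count I q a b" if "a \<in> I" "b \<in> I" for a b
    unfolding below_count_def using assms that by (intro arg_cong [where f = card]) auto
  then show ?thesis
    unfolding pairs_above_def using assms by auto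
qed

lemma borel_measurable_card_pairs_above:
  assumes "finite I"
  shows "(\<lambda>p. real (card (pairs_above I n p))) \<in> borel_measurable (Pi\<^sub>M I (\<lambda>_. borel))"
proof -
  have eq: "real (card (pairs_above I n p)) = (\<Sum>e\<in>I \<times> I. if e \<in> pairs_above I n p then 1 else 0)" for p
  proof -
    have "pairs_above I n p \<subseteq> I \<times> I" by (auto simp: pairs_above_def)
    then show ?thesis
      using assms by (simp add: sum.If_cases Int_absorb1)
  qed
  show ?thesis
    unfolding eq
  proof (rule borel_measurable_sum)
    fix e assume "e \<in> I \<times> I"
    then have [measurable]: "Measurable.pred (Pi\<^sub>M I (\<lambda>_. borel)) (\<lambda>p. e \<in> pairs_above I n p)"
      using pred_pairs_above by (cases e) auto
    show "(\<lambda>p. if e \<in> pairs_above I n p then 1 else 0 :: real) \<in> borel_measurable (Pi\<^sub>M I (\<lambda>_. borel))"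
      by measurable
  qed
qed

lemma falling_factorial_nonneg: "real r - 1 \<le> a \<Longrightarrow> 0 \<le> falling_factorial a r"
  unfolding falling_factorial_def by (rule prod_nonneg) auto

theorem proposition4:
  fixes M :: "'a measure" and X :: "nat \<Rightarrow> 'a \<Rightarrow> real \<times> real" and m j :: nat
  assumes "prob_space M"
    and "m \<ge> 2"
    and "prob_space.indep_vars M (\<lambda>_. borel) X {1..m}"
    and "\<And>i. i \<in> {1..m} \<Longrightarrow> distributed M lborel (X i) (\<lambda>z. ennreal (archimedes_density z))"
    and "1 \<le> j" and "j \<le> m - 1"
  shows "prob_space.expectation M (\<lambda>\<omega>. real (swaps_at (geometric_network m (\<lambda>i. X i \<omega>)) j)) =
    falling_factorial (real j - 1/2) (j - 1) * falling_factorial (real m - real j - 1/2) (m - j - 1)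
      / (fact (j - 1) * fact (m - j - 1))"
proof -
  interpret prob_space M by fact
  \<comment> \<open>Of the \<open>m - 2\<close> points off the line, \<open>n\<close> are to lie
    below it and \<open>k\<close> are the rest.\<close>
  define n k where "n = j - 1" and "k = m - j - 1"
  have j: "j = Suc n" and m: "m = n + k + 2"
    using assms(2,5,6) by (auto simp: n_def k_def)
  let ?I = "{1..m}" and ?D = archimedes_measure
  let ?B = "Pi\<^sub>M {1..m} (\<lambda>_. borel :: (real \<times> real) measure)"
  define val where "val = falling_factorial (real n + 1 / 2) n * falling_factorial (real k + 1 / 2) k
    / (fact n * fact k)"
  have law: "distr M borel (X i) = ?D" if "i \<in> ?I" for i
  proof -
    have "distr M borel (X i) = distr M lborel (X i)"
      by (rule distr_cong) simp_all
    then show ?thesis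
      using distributed_distr_eq_density [OF assms(4) [OF that]] by (simp add: archimedes_measure_def)
  qed
  have X: "X i \<in> M \<rightarrow>\<^sub>M borel" if "i \<in> ?I" for i
    using distributed_measurable [OF assms(4) [OF that]] by simp
  have prob_D: "prob_space ?D"
    using law [of 1] prob_space_distr [OF X, of 1] assms(2) by simp
  define Y where "Y \<omega> = (\<lambda>i\<in>?I. X i \<omega>)" for \<omega>
  have Y: "Y \<in> M \<rightarrow>\<^sub>M ?B"
    unfolding Y_def using X by (rule measurable_restrict)
  have "distr M ?B Y = Pi\<^sub>M ?I (\<lambda>i. distr M borel (X i))"
    using assms(2,3) X unfolding Y_def by (subst (asm) indep_vars_iff_distr_eq_PiM') auto
  also have "\<dots> = Pi\<^sub>M ?I (\<lambda>_. ?D)"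
    by (rule PiM_cong) (simp_all add: law del: atLeastAtMost_iff)
  finally have distr_Y: "distr M ?B Y = Pi\<^sub>M ?I (\<lambda>_. ?D)" .
  \<comment> \<open>The value 0 matches the empty dummy network, so \<open>h (Y \<omega>)\<close>
    equals the number of swaps for every \<omega>, not only almost surely.\<close>
  define h where "h p = (if general_position m p then real (card (pairs_above ?I n p)) else 0)" for p
  have h_meas: "h \<in> borel_measurable ?B"
    unfolding h_def using pred_general_position [of m]
    by (intro measurable_If borel_measurable_card_pairs_above) (auto simp: pred_def)
  have h_meas': "(\<lambda>p. ennreal (h p)) \<in> borel_measurable ?B"
    by (rule measurable_compose [OF h_meas measurable_ennreal])
  have swaps: "real (swaps_at (geometric_network m (\<lambda>i. X i \<omega>)) j) = h (Y \<omega>)" for \<omega>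
  proof -
    have gp: "general_position m (Y \<omega>) \<longleftrightarrow> general_position m (\<lambda>i. X i \<omega>)"
      by (rule general_position_cong) (simp add: Y_def)
    have pa: "pairs_above ?I n (Y \<omega>) = pairs_above ?I n (\<lambda>i. X i \<omega>)"
      by (rule pairs_above_cong) (simp add: Y_def)
    show ?thesis
    proof (cases "general_position m (\<lambda>i. X i \<omega>)")
      case True
      then show ?thesis
        using swaps_at_geometric_network [OF True, of n] by (simp only: h_def gp pa j if_True)
    next
      case False
      then show ?thesis
        by (simp add: h_def gp geometric_network_def swaps_at_def)
    qed
  qed
  have "expectation (\<lambda>\<omega>. h (Y \<omega>)) = enn2real (\<integral>\<^sup>+\<omega>. ennreal (h (Y \<omega>)) \<partial>M)"
    using measurable_compose [OF Y h_meas] by (intro integral_eq_nn_integral) (auto simp: h_def)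
  also have "(\<integral>\<^sup>+\<omega>. ennreal (h (Y \<omega>)) \<partial>M) = (\<integral>\<^sup>+p. ennreal (h p) \<partial>Pi\<^sub>M ?I (\<lambda>_. ?D))"
    unfolding distr_Y [symmetric]
    by (rule nn_integral_distr [OF Y, symmetric]) (simp only: measurable_distr_eq1 h_meas')
  also have "\<dots> = (\<integral>\<^sup>+p. of_nat (card (pairs_above ?I n p)) \<partial>Pi\<^sub>M ?I (\<lambda>_. ?D))"
    using AE_general_position [OF prob_D, of m]
    by (intro nn_integral_cong_AE) (auto simp: h_def ennreal_of_nat_eq_real_of_nat elim!: eventually_mono)
  also have "\<dots> = ennreal val"
    unfolding val_def by (rule nn_integral_card_pairs_above [OF prob_D]) (simp_all add: m)
  also have "enn2real (ennreal val) = val"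
    unfolding val_def by (simp add: falling_factorial_nonneg)
  finally have E: "expectation (\<lambda>\<omega>. h (Y \<omega>)) = val" .
  have "real j - 1 / 2 = real n + 1 / 2" "real m - real j - 1 / 2 = real k + 1 / 2"
    by (auto simp: j m)
  then show ?thesis
    by (simp only: swaps E val_def n_def [symmetric] k_def [symmetric])
qed

end
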